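(* Let $n$ be a positive integer and let $K$ be a field such that $|K| \geq n+1$. Then the maximal dimension of an affine subspace $\mathcal{S}$ of $M(n \times n, K)$ such that every element of $\mathcal{S}$ is nilpotent and has rank equal to $n-1$ is $$\frac{(n-1)(n-2)}{2}.$$
   Context: $M(n\times n,K)$ denotes the $K$-vector space of $n \times n$ matrices over $K$. An affine subspace of a vector space $\mathcal{V}$ is a subset of the form $a+\mathcal{Z}$ with $a\in\mathcal{V}$ and $\mathcal{Z}$ a vector subspace of $\mathcal{V}$ (so it is nonempty and need not contain $0$); $\mathcal{Z}$ is called its direction, and the dimension of the affine subspace is $\dim(\mathcal{Z})$. "Maximal dimension" means that the stated value is attained by some such affine subspace and no such affine subspace has larger dimension. The field $K$ may be infinite. *)

theory Defs
  imports "Jordan_Normal_Form.DL_Rank" "HOL-Algebra.AbelCoset"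
begin

text \<open>
  \<^const>\<open>module_mat\<close> with \<^term>\<open>class_ring\<close> as scalars is the vector space of matrices; its
  multiplicative fields play no role here.
\<close>

abbreviation mat_space :: "'a::field itself \<Rightarrow> nat \<Rightarrow> ('a, 'a mat) module" where
  "mat_space ty n \<equiv> module_mat ty n n"

lemma vectorspace_mat_space:
  "vectorspace (class_ring :: 'a::field ring) (mat_space TYPE('a) n)"
  unfolding vectorspace_def
  by (intro conjI moduleI abelian_group_mat class_field class_cring.is_cring)
    (auto simp: module_mat_simps add_smult_distrib_left_mat add_smult_distrib_right_mat
      intro!: eq_matI)

definition affine_subspace_along ::
  "('a, 'k) ring_scheme \<Rightarrow> ('a, 'v, 'm) module_scheme \<Rightarrow> 'v set \<Rightarrow> 'v set \<Rightarrow> bool" where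
  "affine_subspace_along K V Z S \<longleftrightarrow>
     VectorSpace.subspace K Z V \<and> (\<exists>a \<in> carrier V. S = a <+\<^bsub>V\<^esub> Z)"

definition affine_subspace ::
  "('a, 'k) ring_scheme \<Rightarrow> ('a, 'v, 'm) module_scheme \<Rightarrow> 'v set \<Rightarrow> bool" where
  "affine_subspace K V S \<longleftrightarrow> (\<exists>Z. affine_subspace_along K V Z S)"

text \<open>The direction is unique by lemma \<open>affine_direction_eq\<close> below.\<close>

definition affine_direction ::
  "('a, 'k) ring_scheme \<Rightarrow> ('a, 'v, 'm) module_scheme \<Rightarrow> 'v set \<Rightarrow> 'v set" where
  "affine_direction K V S = (THE Z. affine_subspace_along K V Z S)"

definition affine_subspace_dim ::
  "('a, 'k) ring_scheme \<Rightarrow> ('a, 'v, 'm) module_scheme \<Rightarrow> 'v set \<Rightarrow> nat" where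
  "affine_subspace_dim K V S = vectorspace.dim K (V\<lparr>carrier := affine_direction K V S\<rparr>)"

lemma affine_subspace_along_differences:
  assumes "affine_subspace_along K V Z S"
  shows "Z = {x \<ominus>\<^bsub>V\<^esub> y | x y. x \<in> S \<and> y \<in> S}"
proof -
  from assms obtain a where sub: "VectorSpace.subspace K Z V"
    and a: "a \<in> carrier V" and S: "S = a <+\<^bsub>V\<^esub> Z"
    unfolding affine_subspace_along_def by blast
  interpret vectorspace K V using sub by (simp add: VectorSpace.subspace_def)
  interpret Z: submodule K Z V using sub by (simp add: VectorSpace.subspace_def)
  have S': "S = {a \<oplus>\<^bsub>V\<^esub> z | z. z \<in> Z}"
    unfolding S a_l_coset_def l_coset_def by auto
  have ZV: "z \<in> carrier V" if "z \<in> Z" for z using that Z.subset by blast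
  have diff: "(a \<oplus>\<^bsub>V\<^esub> z) \<ominus>\<^bsub>V\<^esub> (a \<oplus>\<^bsub>V\<^esub> w) = z \<ominus>\<^bsub>V\<^esub> w"
    if "z \<in> Z" "w \<in> Z" for z w
  proof -
    have "(a \<oplus>\<^bsub>V\<^esub> z) \<ominus>\<^bsub>V\<^esub> (a \<oplus>\<^bsub>V\<^esub> w)
        = (a \<oplus>\<^bsub>V\<^esub> z) \<oplus>\<^bsub>V\<^esub> (\<ominus>\<^bsub>V\<^esub> a \<oplus>\<^bsub>V\<^esub> \<ominus>\<^bsub>V\<^esub> w)"
      using a ZV that by (simp add: M.minus_eq M.minus_add)
    also have "\<dots> = \<ominus>\<^bsub>V\<^esub> a \<oplus>\<^bsub>V\<^esub> (a \<oplus>\<^bsub>V\<^esub> (z \<oplus>\<^bsub>V\<^esub> \<ominus>\<^bsub>V\<^esub> w))"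
      using a ZV that by (simp add: M.a_ac)
    also have "\<dots> = z \<ominus>\<^bsub>V\<^esub> w"
      using a ZV that by (simp add: M.r_neg1 M.minus_eq)
    finally show ?thesis .
  qed
  have neg: "\<ominus>\<^bsub>V\<^esub> w \<in> Z" if "w \<in> Z" for w
    using Z.smult_closed[of "\<ominus>\<^bsub>K\<^esub> \<one>\<^bsub>K\<^esub>" w] that ZV
    by (simp add: smult_l_minus)
  have closed: "z \<ominus>\<^bsub>V\<^esub> w \<in> Z" if "z \<in> Z" "w \<in> Z" for z w
    using that neg by (simp add: M.minus_eq)
  show ?thesis
  proof (intro equalityI subsetI)
    fix z assume z: "z \<in> Z"
    have "z = (a \<oplus>\<^bsub>V\<^esub> z) \<ominus>\<^bsub>V\<^esub> (a \<oplus>\<^bsub>V\<^esub> \<zero>\<^bsub>V\<^esub>)"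
      using diff[OF z Z.zero_closed] ZV[OF z] by (simp add: M.minus_eq)
    then show "z \<in> {x \<ominus>\<^bsub>V\<^esub> y | x y. x \<in> S \<and> y \<in> S}"
      unfolding S' using z Z.zero_closed by blast
  next
    fix z assume "z \<in> {x \<ominus>\<^bsub>V\<^esub> y | x y. x \<in> S \<and> y \<in> S}"
    then show "z \<in> Z" unfolding S' using diff closed by auto
  qed
qed

lemma affine_direction_eq:
  assumes "affine_subspace_along K V Z S"
  shows "affine_direction K V S = Z"
  unfolding affine_direction_def
  using assms by (metis (no_types, lifting) affine_subspace_along_differences the_equality)

definition nilpotent_mat :: "'a::semiring_1 mat \<Rightarrow> bool" where
  "nilpotent_mat A \<longleftrightarrow> square_mat A \<and> (\<exists>k. A ^\<^sub>m k = 0\<^sub>m (dim_row A) (dim_row A))"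

end

theory Submission
  imports Defs "Jordan_Normal_Form.Jordan_Normal_Form" "Jordan_Normal_Form.Matrix_Kernel"
begin

text \<open>
  Let \<open>S = a + Z\<close> be an affine space of nilpotent matrices of rank \<open>n - 1\<close>. After a change of basis,
  \<open>a\<close> is the nilpotent Jordan block \<open>J\<close>, whose kernel is spanned by the first unit vector \<open>e\<close>. Let \<open>p\<close>
  be least such that \<open>(J + B)\<^sup>p e = 0\<close> for all \<open>B \<in> Z\<close>. As the field has more than \<open>n\<close> elements, the
  coefficient of \<open>t\<close> in \<open>(J + t B)\<^sup>p e\<close> vanishes, that is \<open>J\<^bsup>p-1\<^esup> B e = 0\<close>; since moreover \<open>B e\<close> is a
  multiple of \<open>e\<close> only if it is zero, the space \<open>Z e\<close> has dimension at most \<open>p - 2\<close> (or \<open>0\<close>, if \<open>p = 1\<close>).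
  If \<open>e y\<^sup>T \<in> Z\<close>, then \<open>y\<close> is orthogonal to all \<open>(J + B)\<^sup>k e\<close>, because adding \<open>e y\<^sup>T\<close> to \<open>J + B\<close> preserves
  nilpotency. For suitable \<open>B\<close> these vectors span a space of dimension \<open>p\<close>, so the matrices \<open>e y\<^sup>T\<close> in
  \<open>Z\<close> form a space of dimension at most \<open>n - p\<close> (and \<open>n - 2\<close>, if \<open>p = 1\<close>: then \<open>y\<close> is also orthogonal to
  the second unit vector, by the rank condition). Together these contribute at most \<open>n - 2\<close> to the
  dimension of \<open>Z\<close>, and what remains is the space of lower right blocks of those \<open>B \<in> Z\<close> with
  \<open>B e = 0\<close>, to which induction applies. The bound is attained by \<open>J\<close> plus the matrices supported
  strictly above the superdiagonal.
\<close>

section \<open>Iterated matrix-vector products and rank-one perturbations\<close>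

abbreviation iter :: "'a::semiring_0 mat \<Rightarrow> nat \<Rightarrow> 'a vec \<Rightarrow> 'a vec" where
  "iter A k v \<equiv> ((*\<^sub>v) A ^^ k) v"

lemma iter_carrier [simp]:
  assumes "A \<in> carrier_mat n n" "v \<in> carrier_vec n"
  shows "iter A k v \<in> carrier_vec n"
  using assms by (induction k) auto

lemma dim_iter [simp]:
  assumes "A \<in> carrier_mat n n" "v \<in> carrier_vec n"
  shows "dim_vec (iter A k v) = n"
  using iter_carrier[OF assms] by auto

lemma iter_add_exp: "iter A (j + k) v = iter A j (iter A k v)"
  by (simp add: funpow_add)

lemma iter_zero [simp]: "A \<in> carrier_mat n n \<Longrightarrow> iter A k (0\<^sub>v n) = 0\<^sub>v n"
  by (induction k) auto

lemma iter_smult: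
  fixes A :: "'a::field mat"
  assumes "A \<in> carrier_mat n n" "v \<in> carrier_vec n"
  shows "iter A k (c \<cdot>\<^sub>v v) = c \<cdot>\<^sub>v iter A k v"
  using assms by (induction k) (auto simp: mult_mat_vec)

lemma iter_minus:
  fixes A :: "'a::field mat"
  assumes "A \<in> carrier_mat n n" "v \<in> carrier_vec n" "w \<in> carrier_vec n"
  shows "iter A k (v - w) = iter A k v - iter A k w"
  using assms by (induction k) (auto simp: mult_minus_distrib_mat_vec[where nr = n and nc = n])

lemma iter_mono_zero:
  assumes "A \<in> carrier_mat n n" "iter A k v = 0\<^sub>v n" "k \<le> l"
  shows "iter A l v = 0\<^sub>v n"
  using iter_add_exp[of "l - k" k A v] assms by simp

lemma pow_mat_mult_vec:
  fixes A :: "'a::field mat"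
  assumes "A \<in> carrier_mat n n" "v \<in> carrier_vec n"
  shows "A ^\<^sub>m k *\<^sub>v v = iter A k v"
  using assms(2)
proof (induction k arbitrary: v)
  case (Suc k)
  then have "A ^\<^sub>m Suc k *\<^sub>v v = A ^\<^sub>m k *\<^sub>v (A *\<^sub>v v)"
    using assms(1) by (simp add: assoc_mult_mat_vec[of _ n n _ n])
  also have "\<dots> = iter A k (A *\<^sub>v v)"
    using Suc assms(1) by simp
  finally show ?case
    by (simp add: funpow_swap1)
qed (use assms in auto)

lemma nilpotent_mat_iff_iter:
  fixes A :: "'a::field mat"
  assumes A: "A \<in> carrier_mat n n"
  shows "nilpotent_mat A \<longleftrightarrow> (\<exists>k. \<forall>v\<in>carrier_vec n. iter A k v = 0\<^sub>v n)"
proof -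
  have "A ^\<^sub>m k = 0\<^sub>m n n \<longleftrightarrow> (\<forall>v\<in>carrier_vec n. iter A k v = 0\<^sub>v n)" for k
  proof
    assume "A ^\<^sub>m k = 0\<^sub>m n n"
    then show "\<forall>v\<in>carrier_vec n. iter A k v = 0\<^sub>v n"
      using pow_mat_mult_vec[OF A, symmetric] by (auto intro!: eq_vecI)
  next
    assume z: "\<forall>v\<in>carrier_vec n. iter A k v = 0\<^sub>v n"
    show "A ^\<^sub>m k = 0\<^sub>m n n"
    proof (rule eq_matI)
      fix i j assume ij: "i < dim_row (0\<^sub>m n n)" "j < dim_col (0\<^sub>m n n)"
      have "A ^\<^sub>m k *\<^sub>v unit_vec n j = 0\<^sub>v n"
        using z pow_mat_mult_vec[OF A] by simp
      moreover have "(A ^\<^sub>m k *\<^sub>v unit_vec n j) $ i = (A ^\<^sub>m k) $$ (i, j)"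
        using ij A by (simp add: scalar_prod_right_unit[of _ n])
      ultimately show "(A ^\<^sub>m k) $$ (i, j) = 0\<^sub>m n n $$ (i, j)"
        using ij by simp
    qed (use A in auto)
  qed
  then show ?thesis
    using A by (auto simp: nilpotent_mat_def)
qed

text \<open>A discrete Duhamel formula for C = e y^T. Splitting off the leftmost factor of (A +
  C)^(k+1) leaves \<open>A\<close> acting on the iterate, and this \<open>A\<close> is moved to
  \<open>z\<close> as a transpose; hence \<open>z\<close> stays arbitrary in the induction.\<close>

lemma iter_rank_one_perturbation:
  fixes A :: "'a::field mat"
  assumes A: "A \<in> carrier_mat n n" and C: "C \<in> carrier_mat n n"
    and e: "e \<in> carrier_vec n"
    and C_mult: "\<And>v. v \<in> carrier_vec n \<Longrightarrow> C *\<^sub>v v = (y \<bullet> v) \<cdot>\<^sub>v e"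
    and z: "z \<in> carrier_vec n"
  shows "z \<bullet> iter (A + C) k e =
    z \<bullet> iter A k e + (\<Sum>i<k. (y \<bullet> iter (A + C) i e) * (z \<bullet> iter A (k - 1 - i) e))"
  using z
proof (induction k arbitrary: z)
  case (Suc k)
  define w where "w = iter (A + C) k e"
  have AC: "A + C \<in> carrier_mat n n" using A C by auto
  have w: "w \<in> carrier_vec n" unfolding w_def using AC e by (rule iter_carrier)
  have At: "A\<^sup>T *\<^sub>v z \<in> carrier_vec n"
    by (rule mult_mat_vec_carrier[of _ n n]) (use A Suc.prems in auto)
  have tr: "(A\<^sup>T *\<^sub>v z) \<bullet> x = z \<bullet> (A *\<^sub>v x)" if "x \<in> carrier_vec n" for x
    using transpose_vec_mult_scalar[OF A that Suc.prems] .
  have "z \<bullet> iter (A + C) (Suc k) e = z \<bullet> (A *\<^sub>v w + C *\<^sub>v w)"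
    using A C w by (simp add: w_def add_mult_distrib_mat_vec[of _ n n])
  also have "\<dots> = (A\<^sup>T *\<^sub>v z) \<bullet> w + (y \<bullet> w) * (z \<bullet> e)"
    using A C w e Suc.prems by (simp add: scalar_prod_add_distrib[of _ n] C_mult tr)
  also have "(A\<^sup>T *\<^sub>v z) \<bullet> w = z \<bullet> iter A (Suc k) e +
      (\<Sum>i<k. (y \<bullet> iter (A + C) i e) * (z \<bullet> iter A (Suc (k - 1 - i)) e))"
    using Suc.IH[OF At] A e by (simp add: w_def tr)
  also have "(\<Sum>i<k. (y \<bullet> iter (A + C) i e) * (z \<bullet> iter A (Suc (k - 1 - i)) e)) =
      (\<Sum>i<k. (y \<bullet> iter (A + C) i e) * (z \<bullet> iter A (k - i) e))"
    by (intro sum.cong refl) (auto simp: Suc_diff_Suc simp del: funpow.simps)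
  finally show ?case
    by (simp add: w_def algebra_simps)
qed simp

text \<open>With \<open>F = \<Sum> (y \<bullet> A\<^sup>k e) X\<^sup>k\<close> and \<open>G = \<Sum> (y \<bullet> (A + C)\<^sup>k e) X\<^sup>k\<close>, the perturbation formula
  reads \<open>(1 - X F) (1 + X G) = 1\<close>, and both series are polynomials by nilpotency.\<close>

lemma nilpotent_rank_one_perturbation:
  fixes A :: "'a::field mat"
  assumes A: "A \<in> carrier_mat n n" and C: "C \<in> carrier_mat n n"
    and e: "e \<in> carrier_vec n" and y: "y \<in> carrier_vec n"
    and C_mult: "\<And>v. v \<in> carrier_vec n \<Longrightarrow> C *\<^sub>v v = (y \<bullet> v) \<cdot>\<^sub>v e"
    and nilA: "nilpotent_mat A" and nilAC: "nilpotent_mat (A + C)"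
  shows "y \<bullet> iter A k e = 0"
proof -
  have AC: "A + C \<in> carrier_mat n n" using A C by auto
  define f where "f k = y \<bullet> iter A k e" for k
  define g where "g k = y \<bullet> iter (A + C) k e" for k
  obtain a where a: "\<forall>v\<in>carrier_vec n. iter A a v = 0\<^sub>v n"
    using nilA nilpotent_mat_iff_iter[OF A] by blast
  obtain b where b: "\<forall>v\<in>carrier_vec n. iter (A + C) b v = 0\<^sub>v n"
    using nilAC nilpotent_mat_iff_iter[OF AC] by blast
  have f0: "f k = 0" if "k \<ge> a" for k
    using iter_mono_zero[OF A _ that, of e] a e y by (simp add: f_def)
  have g0: "g k = 0" if "k \<ge> b" for k
    using iter_mono_zero[OF AC _ that, of e] b e y by (simp add: g_def)
  define F where "F = Abs_poly f"
  define G where "G = Abs_poly g"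
  have F: "coeff F k = f k" for k unfolding F_def
    by (subst Abs_poly_inverse) (auto simp: MOST_nat intro!: exI[of _ a] f0)
  have G: "coeff G k = g k" for k unfolding G_def
    by (subst Abs_poly_inverse) (auto simp: MOST_nat intro!: exI[of _ b] g0)
  have rec: "g k = f k + (\<Sum>i<k. g i * f (k - 1 - i))" for k
    using iter_rank_one_perturbation[OF A C e C_mult y, of k] by (simp add: f_def g_def)
  have "G = F + pCons 0 (G * F)"
  proof (rule poly_eqI)
    fix k
    show "coeff G k = coeff (F + pCons 0 (G * F)) k"
      using rec[of k]
      by (cases k) (simp_all add: F G coeff_mult lessThan_Suc_atMost)
  qed
  then have "(1 - pCons 0 F) * (1 + pCons 0 G) = 1"
    by (simp add: algebra_simps)
  \<comment> \<open>A unit of the polynomial ring is a constant, and 1 - X F is constant only if F =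
    0.\<close>
  then have "1 - pCons 0 F dvd 1" by (metis dvd_triv_left)
  then obtain c where "1 - pCons 0 F = [:c:]" by (meson is_unit_poly_iff)
  then have "F = 0" by (simp add: one_pCons)
  then show ?thesis using F[of k] by (simp add: f_def)
qed

section \<open>Krylov vectors and Jordan bases\<close>

context vec_space
begin

text \<open>The rows of \<open>A\<close> lie in the orthogonal complement of \<open>S\<close>, which
  is also that of \<open>span S\<close>.\<close>

lemma mult_span_zero:
  fixes A :: "'a mat"
  assumes A: "A \<in> carrier_mat n n" and S: "S \<subseteq> carrier_vec n"
    and z: "\<And>s. s \<in> S \<Longrightarrow> A *\<^sub>v s = 0\<^sub>v n" and v: "v \<in> span S"
  shows "A *\<^sub>v v = 0\<^sub>v n"
proof -
  have "row A i \<bullet> v = 0" if i: "i < n" for i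
  proof -
    have "row A i \<bullet> s = (A *\<^sub>v s) $ i" for s using i A by simp
    then have "row A i \<bullet> s = 0" if "s \<in> S" for s
      using z[OF that] i by simp
    then have "row A i \<in> orthogonal_complement S"
      using A by (auto simp: orthogonal_complement_def)
    then show ?thesis
      using v in_orthogonal_complement_span[OF S] by (auto simp: orthogonal_complement_def)
  qed
  then show ?thesis using A by (auto intro!: eq_vecI)
qed

text \<open>The chain is built up from its end: A^j kills the last j vectors and hence their span,
  but sends the vector before them to A^(p-1) e, which is nonzero. So that vector lies outside the
  span.\<close>

lemma krylov_lin_indpt:
  fixes A :: "'a mat"
  assumes A: "A \<in> carrier_mat n n" and e: "e \<in> carrier_vec n"
    and p: "iter A p e = 0\<^sub>v n" "\<And>q. q < p \<Longrightarrow> iter A q e \<noteq> 0\<^sub>v n"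
  shows "lin_indpt ((\<lambda>k. iter A k e) ` {..<p}) \<and> card ((\<lambda>k. iter A k e) ` {..<p}) = p"
proof -
  have car: "iter A k e \<in> carrier_vec n" for k using A e by simp
  have "lin_indpt ((\<lambda>k. iter A k e) ` {p - j..<p}) \<and> card ((\<lambda>k. iter A k e) ` {p - j..<p}) = j"
    if "j \<le> p" for j
    using that
  proof (induction j)
    case 0
    then show ?case by (simp add: finite_lin_indpt2)
  next
    case (Suc j)
    let ?T = "(\<lambda>k. iter A k e) ` {p - j..<p}"
    let ?x = "iter A (p - Suc j) e"
    have T: "?T \<subseteq> carrier_vec n" using car by auto
    have "A ^\<^sub>m j *\<^sub>v s = 0\<^sub>v n" if s: "s \<in> ?T" for s
    proof -
      obtain k where k: "k \<ge> p - j" "s = iter A k e" using s by auto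
      then have "A ^\<^sub>m j *\<^sub>v s = iter A (j + k) e"
        using pow_mat_mult_vec[OF A car] by (simp add: iter_add_exp)
      then show ?thesis using iter_mono_zero[OF A p(1), of "j + k"] k by simp
    qed
    then have kill: "A ^\<^sub>m j *\<^sub>v v = 0\<^sub>v n" if "v \<in> span ?T" for v
      using mult_span_zero[OF _ T _ that, of "A ^\<^sub>m j"] A by simp
    have "A ^\<^sub>m j *\<^sub>v ?x = iter A (j + (p - Suc j)) e"
      using pow_mat_mult_vec[OF A car] by (simp add: iter_add_exp)
    also have "j + (p - Suc j) = p - 1" using Suc.prems by simp
    finally have "A ^\<^sub>m j *\<^sub>v ?x \<noteq> 0\<^sub>v n" using p(2) Suc.prems by simp
    then have notin: "?x \<notin> span ?T" using kill by blast
    then have notinT: "?x \<notin> ?T" using T span_mem by blast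
    have "{p - Suc j..<p} = insert (p - Suc j) {p - j..<p}"
      using Suc.prems by auto
    then have ins: "(\<lambda>k. iter A k e) ` {p - Suc j..<p} = ?T \<union> {?x}" by auto
    have "lin_indpt (?T \<union> {?x})"
      using lin_dep_iff_in_span[OF T _ car notinT] Suc notin by simp
    moreover have "card (?T \<union> {?x}) = Suc j"
      using notinT Suc by simp
    ultimately show ?case unfolding ins by blast
  qed
  from this[of p] show ?thesis by (simp add: atLeast0LessThan)
qed

text \<open>Steinitz replacement against the unit vectors completes \<open>T\<close> to a spanning
  set, and only the zero vector is orthogonal to a spanning set. Pairings with \<open>C\<close> thus
  detect any vector already known to be orthogonal to \<open>T\<close>.\<close>

lemma orthogonal_extension:
  assumes T: "T \<subseteq> carrier_vec n" and fin: "finite T" and li: "lin_indpt T"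
  obtains C where "finite C" "C \<subseteq> carrier_vec n" "card C + card T \<le> n"
    "\<And>y. y \<in> carrier_vec n \<Longrightarrow> (\<And>u. u \<in> T \<union> C \<Longrightarrow> y \<bullet> u = 0) \<Longrightarrow> y = 0\<^sub>v n"
proof -
  have U: "set (unit_vecs n) \<subseteq> carrier_vec n" by (rule unit_vecs_carrier)
  have cU: "card (set (unit_vecs n)) = n"
    using distinct_card[OF unit_vecs_distinct] by (simp add: unit_vecs_length)
  from replacement[OF fin _ U li] obtain C where
    C: "finite C" "C \<subseteq> carrier_vec n" "int (card C) \<le> int n - int (card T)"
    and sp: "span (T \<union> C) = span (set (unit_vecs n))"
    using T cU by (metis List.finite_set span_unit_vecs_is_carrier)
  show ?thesis
  proof (rule that[OF C(1,2)])
    show "card C + card T \<le> n" using C(3) by simp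
    fix y assume y: "y \<in> carrier_vec n" and 0: "\<And>u. u \<in> T \<union> C \<Longrightarrow> y \<bullet> u = 0"
    have "y \<in> orthogonal_complement (T \<union> C)"
      using y 0 by (simp add: orthogonal_complement_def)
    then have "y \<in> orthogonal_complement (carrier_vec n)"
      using in_orthogonal_complement_span[of "T \<union> C"] T C(2) sp
      by (simp add: span_unit_vecs_is_carrier)
    then have "y \<bullet> unit_vec n i = 0" if "i < n" for i
      by (auto simp: orthogonal_complement_def)
    then show "y = 0\<^sub>v n" using y by (auto intro!: eq_vecI)
  qed
qed

text \<open>Let m be the nilpotency index and \<open>w\<close> a vector with A^(m-1) w nonzero. As
  the kernel is at most a line, the kernel of A^j lies in the span of the chain of \<open>w\<close>
  for each j \<le> m. For j = m this kernel is the whole space, so the m independent chain vectors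
  form a basis and m = n.\<close>

lemma jordan_chain_exists:
  fixes A :: "'a mat"
  assumes n: "0 < n" and A: "A \<in> carrier_mat n n" and nil: "nilpotent_mat A"
    and ker: "\<exists>u. \<forall>v\<in>carrier_vec n. A *\<^sub>v v = 0\<^sub>v n \<longrightarrow> (\<exists>c. v = c \<cdot>\<^sub>v u)"
  obtains w where "w \<in> carrier_vec n" "iter A n w = 0\<^sub>v n" "\<And>q. q < n \<Longrightarrow> iter A q w \<noteq> 0\<^sub>v n"
proof -
  define m where "m = (LEAST k. \<forall>v\<in>carrier_vec n. iter A k v = 0\<^sub>v n)"
  have m0: "\<forall>v\<in>carrier_vec n. iter A m v = 0\<^sub>v n"
    unfolding m_def by (rule LeastI_ex) (use nil nilpotent_mat_iff_iter[OF A] in blast)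
  have m_pos: "0 < m"
  proof (rule ccontr)
    assume "\<not> 0 < m"
    then have "unit_vec n 0 = (0\<^sub>v n :: 'a vec)" using m0 by simp
    then show False using n by simp
  qed
  have "\<not> (\<forall>v\<in>carrier_vec n. iter A (m - 1) v = 0\<^sub>v n)"
    using not_less_Least[of "m - 1" "\<lambda>k. \<forall>v\<in>carrier_vec n. iter A k v = 0\<^sub>v n"] m_pos
    by (simp add: m_def)
  then obtain w where w: "w \<in> carrier_vec n" "iter A (m - 1) w \<noteq> 0\<^sub>v n" by blast
  have wq: "iter A q w \<noteq> 0\<^sub>v n" if "q < m" for q
    using iter_mono_zero[OF A, of q w "m - 1"] w that m_pos by (cases m) auto
  have car: "iter A k w \<in> carrier_vec n" for k using A w by simp
  let ?T = "(\<lambda>k. iter A k w) ` {..<m}"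
  have T: "?T \<subseteq> carrier_vec n" using car by auto
  obtain u where u: "\<And>v. v \<in> carrier_vec n \<Longrightarrow> A *\<^sub>v v = 0\<^sub>v n \<Longrightarrow> \<exists>c. v = c \<cdot>\<^sub>v u"
    using ker by blast
  \<comment> \<open>The last chain vector is a nonzero element of the kernel, so it can replace
    \<open>u\<close> as a generator.\<close>
  have kw: "A *\<^sub>v iter A (m - 1) w = 0\<^sub>v n"
    using m0 w m_pos by (metis Suc_diff_1 comp_apply funpow.simps(2))
  from u[OF car kw] obtain c0 where c0: "iter A (m - 1) w = c0 \<cdot>\<^sub>v u" by blast
  have c00: "c0 \<noteq> 0"
  proof
    assume "c0 = 0"
    then have "iter A (m - 1) w = 0\<^sub>v (dim_vec u)" using c0 by (auto intro!: eq_vecI)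
    moreover have "dim_vec u = n" using c0 A w dim_iter[of A n w "m - 1"] by simp
    ultimately show False using w by simp
  qed
  have u': "\<exists>c. v = c \<cdot>\<^sub>v iter A (m - 1) w" if v: "v \<in> carrier_vec n" "A *\<^sub>v v = 0\<^sub>v n" for v
  proof -
    obtain c where "v = c \<cdot>\<^sub>v u" using u[OF v] by blast
    then have "v = (c / c0) \<cdot>\<^sub>v iter A (m - 1) w"
      unfolding c0 using c00 by (simp add: smult_smult_assoc)
    then show ?thesis by blast
  qed
  have "v \<in> span ?T" if "j \<le> m" "v \<in> carrier_vec n" "iter A j v = 0\<^sub>v n" for j v
    using that
  proof (induction j arbitrary: v)
    case 0
    have "iter A 0 w \<in> ?T" using m_pos by blast
    then have "0 \<cdot>\<^sub>v w \<in> span ?T" using smult_in_span[OF T span_mem[OF T]] by simp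
    moreover have "0 \<cdot>\<^sub>v w = 0\<^sub>v n" using w by (auto intro!: eq_vecI)
    ultimately show ?case using 0 by simp
  next
    case (Suc j)
    \<comment> \<open>A^j v is a multiple c of A^(m-1) w = A^j x, where x = A^(m-1-j) w. So v - c x
      lies in the kernel of A^j, to which the induction hypothesis applies.\<close>
    have "A *\<^sub>v iter A j v = 0\<^sub>v n" using Suc.prems by simp
    then obtain c where c: "iter A j v = c \<cdot>\<^sub>v iter A (m - 1) w"
      using u'[OF iter_carrier[OF A Suc.prems(2)]] by blast
    let ?x = "iter A (m - 1 - j) w"
    have "iter A (m - 1) w = iter A j ?x"
      using iter_add_exp[of j "m - 1 - j" A w] Suc.prems by simp
    then have "iter A j (v - c \<cdot>\<^sub>v ?x) = 0\<^sub>v n"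
      using Suc.prems c A car by (simp add: iter_minus[OF A] iter_smult[OF A])
    then have 1: "v - c \<cdot>\<^sub>v ?x \<in> span ?T"
      using Suc car by simp
    have 2: "?x \<in> span ?T"
      by (rule span_mem[OF T]) (use Suc.prems in auto)
    have "v = (v - c \<cdot>\<^sub>v ?x) + c \<cdot>\<^sub>v ?x"
      using Suc.prems car by (auto intro!: eq_vecI simp: dim_iter[OF A w(1)])
    then show ?case
      using span_add1[OF T 1 smult_in_span[OF T 2]] by metis
  qed
  then have sp: "span ?T = carrier_vec n"
    using m0 span_closed[OF T] by blast
  have li: "lin_indpt ?T" and cT: "card ?T = m"
    using krylov_lin_indpt[OF A w(1) _ wq] m0 w by auto
  have "basis ?T" using li sp T by (simp add: basis_def)
  then have "m = n" using dim_basis[of ?T] cT dim_is_n by simp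
  then show ?thesis using that w(1) m0 wq by blast
qed

text \<open>The columns of \<open>P\<close> are the chain in reverse order, so that \<open>A\<close>
  maps each column to the preceding one and kills column 0. This matches a Jordan block with its
  ones above the diagonal.\<close>

lemma jordan_basis_exists:
  fixes A :: "'a mat"
  assumes n: "0 < n" and A: "A \<in> carrier_mat n n" and nil: "nilpotent_mat A"
    and ker: "\<exists>u. \<forall>v\<in>carrier_vec n. A *\<^sub>v v = 0\<^sub>v n \<longrightarrow> (\<exists>c. v = c \<cdot>\<^sub>v u)"
  obtains P Q where "P \<in> carrier_mat n n" "Q \<in> carrier_mat n n"
    "P * Q = 1\<^sub>m n" "Q * P = 1\<^sub>m n" "Q * A * P = jordan_block n (0::'a)"
proof -
  obtain w where w: "w \<in> carrier_vec n" "iter A n w = 0\<^sub>v n"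
    and wq: "\<And>q. q < n \<Longrightarrow> iter A q w \<noteq> 0\<^sub>v n"
    using jordan_chain_exists[OF assms] by blast
  have car: "iter A k w \<in> carrier_vec n" for k using A w by simp
  define P where "P = mat n n (\<lambda>(i, j). iter A (n - 1 - j) w $ i)"
  have P: "P \<in> carrier_mat n n" by (simp add: P_def)
  have colP: "col P j = iter A (n - 1 - j) w" if "j < n" for j
    using that A w by (auto simp: P_def intro!: eq_vecI)
  have "set (cols P) = (\<lambda>j. iter A (n - 1 - j) w) ` {..<n}"
    using P colP by (auto simp: cols_def image_def)
  also have "\<dots> = (\<lambda>k. iter A k w) ` (\<lambda>j. n - 1 - j) ` {..<n}" by (simp add: image_image)
  also have "(\<lambda>j. n - 1 - j) ` {..<n} = {..<n}"
  proof (intro equalityI subsetI)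
    fix k assume "k \<in> {..<n}"
    then have "k = n - 1 - (n - 1 - k)" "n - 1 - k \<in> {..<n}" by auto
    then show "k \<in> (\<lambda>j. n - 1 - j) ` {..<n}" by blast
  qed auto
  finally have cols: "set (cols P) = (\<lambda>k. iter A k w) ` {..<n}" .
  have li: "lin_indpt (set (cols P))" and card: "card (set (cols P)) = n"
    unfolding cols using krylov_lin_indpt[OF A w(1,2) wq] by auto
  then have "distinct (cols P)" using P by (simp add: card_distinct)
  then have "det P \<noteq> 0"
    using li det_rank_iff[OF P] lin_indpt_full_rank[OF P] by blast
  then obtain Q where Q: "Q \<in> carrier_mat n n" "Q * P = 1\<^sub>m n" "P * Q = 1\<^sub>m n"
    using det_non_zero_imp_unit[OF P] by (auto simp: Units_def ring_mat_def)
  have "A * P = P * jordan_block n (0::'a)"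
  proof (rule eq_matI)
    fix i j assume "i < dim_row (P * jordan_block n (0::'a))" "j < dim_col (P * jordan_block n (0::'a))"
    then have ij: "i < n" "j < n" using P by simp_all
    have "(A * P) $$ (i, j) = (A *\<^sub>v col P j) $ i" using ij A P by simp
    also have "\<dots> = iter A (Suc (n - 1 - j)) w $ i" using ij colP by simp
    also have "\<dots> = (if j = 0 then 0 else P $$ (i, j - 1))"
    proof (cases "j = 0")
      case True
      then have "Suc (n - 1 - j) = n" using n by simp
      then show ?thesis using w ij True by simp
    next
      case False
      then have "Suc (n - 1 - j) = n - 1 - (j - 1)" using ij by simp
      then show ?thesis using ij False by (simp add: P_def)
    qed
    also have "\<dots> = (\<Sum>k<n. P $$ (i, k) * (if Suc k = j then 1 else 0))"
      using ij by (cases j) (simp_all add: if_distrib sum.delta cong: if_cong)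
    also have "\<dots> = (P * jordan_block n (0::'a)) $$ (i, j)"
      using ij P by (auto simp: scalar_prod_def atLeast0LessThan intro!: sum.cong)
    finally show "(A * P) $$ (i, j) = (P * jordan_block n (0::'a)) $$ (i, j)" .
  qed (use A P in auto)
  then have "Q * A * P = Q * (P * jordan_block n (0::'a))"
    using A P Q by (simp add: assoc_mult_mat[of _ n n _ n _ n])
  also have "\<dots> = (Q * P) * jordan_block n (0::'a)"
    by (rule assoc_mult_mat[symmetric, of _ n n _ n _ n]) (use P Q in auto)
  also have "\<dots> = jordan_block n (0::'a)" using Q by simp
  finally show ?thesis using that P Q by blast
qed

end

section \<open>Matrix pencils and regular nilpotent matrices\<close>

lemma smult_mat_mult_vec:
  fixes A :: "'a::field mat"
  assumes "A \<in> carrier_mat m n" "v \<in> carrier_vec n"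
  shows "(c \<cdot>\<^sub>m A) *\<^sub>v v = c \<cdot>\<^sub>v (A *\<^sub>v v)"
  using assms by (auto simp: scalar_prod_def sum_distrib_left mult.assoc intro!: eq_vecI)

text \<open>The Krylov vectors of \<open>v\<close> before the first zero are independent, so there
  are at most n of them.\<close>

lemma nilpotent_iter_dim:
  fixes A :: "'a::field mat"
  assumes A: "A \<in> carrier_mat n n" and nil: "nilpotent_mat A" and v: "v \<in> carrier_vec n"
  shows "iter A n v = 0\<^sub>v n"
proof -
  interpret vec_space "TYPE('a)" n .
  define q where "q = (LEAST k. iter A k v = 0\<^sub>v n)"
  have q: "iter A q v = 0\<^sub>v n"
    unfolding q_def by (rule LeastI_ex) (use nil v nilpotent_mat_iff_iter[OF A] in blast)
  have "lin_indpt ((\<lambda>k. iter A k v) ` {..<q}) \<and> card ((\<lambda>k. iter A k v) ` {..<q}) = q"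
    by (rule krylov_lin_indpt[OF A v q]) (auto simp: q_def dest: not_less_Least)
  moreover have "(\<lambda>k. iter A k v) ` {..<q} \<subseteq> carrier_vec n" using A v by auto
  ultimately have "q \<le> n" using li_le_dim(2)[OF fin_dim] dim_is_n by metis
  then show ?thesis using iter_mono_zero[OF A q] by simp
qed

lemma nilpotent_eigenvalue_zero:
  fixes A :: "'a::field mat"
  assumes A: "A \<in> carrier_mat n n" and nil: "nilpotent_mat A"
    and v: "v \<in> carrier_vec n" "v \<noteq> 0\<^sub>v n" and eig: "A *\<^sub>v v = c \<cdot>\<^sub>v v"
  shows "c = 0"
proof -
  have pow: "iter A k v = c ^ k \<cdot>\<^sub>v v" for k
    using v A by (induction k) (auto simp: mult_mat_vec[OF A] eig smult_smult_assoc mult.commute)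
  have "c ^ n \<cdot>\<^sub>v v = 0\<^sub>v n"
    using nilpotent_iter_dim[OF A nil v(1)] pow by simp
  moreover obtain i where i: "i < n" "v $ i \<noteq> 0"
    using v by (metis carrier_vecD eq_vecI index_zero_vec)
  ultimately have "c ^ n * v $ i = 0"
    using v by (metis carrier_vecD index_smult_vec(1) index_zero_vec(1))
  then show ?thesis using i by simp
qed

text \<open>When (A + t B)^(m+1) v is expanded in powers of t, every product with rightmost factor
  \<open>A\<close> vanishes because A v = 0. So there is no constant term, and the linear
  coefficient is A^m B v alone. The degree bound is what the field size is compared with.\<close>

lemma iter_pencil_poly:
  fixes A B :: "'a::field mat"
  assumes A: "A \<in> carrier_mat n n" and B: "B \<in> carrier_mat n n"
    and v: "v \<in> carrier_vec n" and Av: "A *\<^sub>v v = 0\<^sub>v n"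
  shows "\<forall>i<n. \<exists>q. degree q \<le> Suc m \<and> coeff q 0 = 0 \<and> coeff q 1 = iter A m (B *\<^sub>v v) $ i \<and>
    (\<forall>t. poly q t = iter (A + t \<cdot>\<^sub>m B) (Suc m) v $ i)"
proof (induction m)
  case 0
  show ?case
  proof (intro allI impI)
    fix i assume i: "i < n"
    have "(A + t \<cdot>\<^sub>m B) *\<^sub>v v = t \<cdot>\<^sub>v (B *\<^sub>v v)" for t
      using A B v Av by (simp add: add_mult_distrib_mat_vec[of _ n n] smult_mat_mult_vec[of _ n n])
    then show "\<exists>q. degree q \<le> Suc 0 \<and> coeff q 0 = 0 \<and> coeff q 1 = iter A 0 (B *\<^sub>v v) $ i \<and>
        (\<forall>t. poly q t = iter (A + t \<cdot>\<^sub>m B) (Suc 0) v $ i)"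
      using i B by (intro exI[of _ "[:0, (B *\<^sub>v v) $ i:]"]) simp
  qed
next
  case (Suc m)
  then obtain Q where Q: "\<And>i. i < n \<Longrightarrow> degree (Q i) \<le> Suc m"
      "\<And>i. i < n \<Longrightarrow> coeff (Q i) 0 = 0"
      "\<And>i. i < n \<Longrightarrow> coeff (Q i) 1 = iter A m (B *\<^sub>v v) $ i"
      "\<And>i t. i < n \<Longrightarrow> poly (Q i) t = iter (A + t \<cdot>\<^sub>m B) (Suc m) v $ i"
    by metis
  show ?case
  proof (intro allI impI)
    fix i assume i: "i < n"
    \<comment> \<open>This mirrors w \<mapsto> A w + t B w, with \<open>pCons 0\<close> as
      multiplication by t.\<close>
    define q where "q = (\<Sum>j<n. smult (A $$ (i, j)) (Q j) + pCons 0 (smult (B $$ (i, j)) (Q j)))"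
    have "degree q \<le> Suc (Suc m)"
      unfolding q_def
    proof (rule degree_sum_le)
      fix j assume "j \<in> {..<n}"
      then have "degree (Q j) \<le> Suc m" using Q(1) by simp
      then show "degree (smult (A $$ (i, j)) (Q j) + pCons 0 (smult (B $$ (i, j)) (Q j))) \<le> Suc (Suc m)"
        by (intro degree_add_le) (auto simp: degree_pCons_le intro: le_trans[OF degree_smult_le]
            le_trans[OF degree_pCons_le])
    qed simp
    moreover have "coeff q 0 = 0"
      by (simp add: q_def coeff_sum Q(2))
    moreover have "coeff q 1 = iter A (Suc m) (B *\<^sub>v v) $ i"
    proof -
      have w: "iter A m (B *\<^sub>v v) \<in> carrier_vec n" using A B v by simp
      have "coeff q 1 = (\<Sum>j<n. A $$ (i, j) * iter A m (B *\<^sub>v v) $ j)"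
        using Q(2) Q(3) by (simp add: q_def coeff_sum coeff_pCons)
      also have "\<dots> = (A *\<^sub>v iter A m (B *\<^sub>v v)) $ i"
        using i A w by (simp add: scalar_prod_def atLeast0LessThan)
      finally show ?thesis by simp
    qed
    moreover have "poly q t = iter (A + t \<cdot>\<^sub>m B) (Suc (Suc m)) v $ i" for t
    proof -
      have AB: "A + t \<cdot>\<^sub>m B \<in> carrier_mat n n" using A B by auto
      define w where "w = iter (A + t \<cdot>\<^sub>m B) (Suc m) v"
      have w: "w \<in> carrier_vec n" unfolding w_def by (rule iter_carrier[OF AB v])
      have "poly q t = (\<Sum>j<n. (A + t \<cdot>\<^sub>m B) $$ (i, j) * w $ j)"
        using i A B Q(4) by (simp add: q_def poly_sum w_def algebra_simps del: funpow.simps)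
      also have "\<dots> = ((A + t \<cdot>\<^sub>m B) *\<^sub>v w) $ i"
        using i A B w by (simp add: scalar_prod_def atLeast0LessThan)
      finally show ?thesis by (simp add: w_def)
    qed
    ultimately show "\<exists>q. degree q \<le> Suc (Suc m) \<and> coeff q 0 = 0 \<and>
        coeff q 1 = iter A (Suc m) (B *\<^sub>v v) $ i \<and>
        (\<forall>t. poly q t = iter (A + t \<cdot>\<^sub>m B) (Suc (Suc m)) v $ i)"
      by blast
  qed
qed

lemma poly_eq_0_if_all_roots:
  fixes q :: "'a::field poly"
  assumes "infinite (UNIV :: 'a set) \<or> degree q < card (UNIV :: 'a set)" and "\<And>t. poly q t = 0"
  shows "q = 0"
proof (rule ccontr)
  assume "q \<noteq> 0"
  then show False
    using assms card_poly_roots_bound[of q] poly_roots_finite[of q] by auto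
qed

text \<open>Each coordinate is a polynomial of degree at most m + 1 that vanishes at more than m + 1
  points, so its linear coefficient is zero. This is where the size of the field enters.\<close>

lemma iter_pencil_zero:
  fixes A B :: "'a::field mat"
  assumes A: "A \<in> carrier_mat n n" and B: "B \<in> carrier_mat n n"
    and v: "v \<in> carrier_vec n" and Av: "A *\<^sub>v v = 0\<^sub>v n"
    and K: "infinite (UNIV :: 'a set) \<or> Suc m < card (UNIV :: 'a set)"
    and z: "\<And>t. iter (A + t \<cdot>\<^sub>m B) (Suc m) v = 0\<^sub>v n"
  shows "iter A m (B *\<^sub>v v) = 0\<^sub>v n"
proof (rule eq_vecI)
  fix i assume "i < dim_vec (0\<^sub>v n)"
  then have i: "i < n" by simp
  from iter_pencil_poly[OF A B v Av, of m] i obtain q where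
    q: "degree q \<le> Suc m" "coeff q 1 = iter A m (B *\<^sub>v v) $ i"
       "\<And>t. poly q t = iter (A + t \<cdot>\<^sub>m B) (Suc m) v $ i" by blast
  have "q = 0"
    by (rule poly_eq_0_if_all_roots) (use K q(1,3) z i in \<open>auto simp del: funpow.simps\<close>)
  then show "iter A m (B *\<^sub>v v) $ i = 0\<^sub>v n $ i" using q(2) i by simp
qed (use A B v in simp)

section \<open>Jordan blocks, lower right blocks and regular nilpotent matrices\<close>

lemma jordan_block_iter:
  fixes v :: "'a::field vec"
  assumes v: "v \<in> carrier_vec n" and i: "i < n"
  shows "iter (jordan_block n 0) k v $ i = (if i + k < n then v $ (i + k) else 0)"
  using i
proof (induction k arbitrary: i)
  case (Suc k)
  define w where "w = iter (jordan_block n 0) k v"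
  have w: "w \<in> carrier_vec n"
    unfolding w_def by (rule iter_carrier) (simp_all add: v)
  have "(jordan_block n 0 *\<^sub>v w) $ i = (\<Sum>j<n. (if j = Suc i then 1 else 0) * w $ j)"
    using Suc.prems w by (auto simp: scalar_prod_def atLeast0LessThan intro!: sum.cong)
  also have "\<dots> = (\<Sum>j<n. if j = Suc i then w $ j else 0)"
    by (intro sum.cong) auto
  also have "\<dots> = (if Suc i < n then w $ Suc i else 0)"
    by simp
  finally show ?case using Suc.IH[of "Suc i"] by (simp add: w_def)
qed (use assms in simp)

text \<open>If the first column of \<open>A\<close> is zero, this is the matrix induced by
  \<open>A\<close> on the quotient by the line of the first unit vector.\<close>

definition lower_block :: "'a mat \<Rightarrow> 'a mat" where
  "lower_block A = mat (dim_row A - 1) (dim_col A - 1) (\<lambda>(i, j). A $$ (Suc i, Suc j))"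

text \<open>For n > 0 a nilpotent matrix has a nonzero kernel, so the last condition amounts to rank
  n - 1. Stated through a generator \<open>u\<close>, it passes to lower blocks and to similar
  matrices by plain vector computations.\<close>

definition regular_nilpotent :: "nat \<Rightarrow> 'a::field mat \<Rightarrow> bool" where
  "regular_nilpotent n A \<longleftrightarrow> A \<in> carrier_mat n n \<and> nilpotent_mat A \<and>
    (\<exists>u. \<forall>v\<in>carrier_vec n. A *\<^sub>v v = 0\<^sub>v n \<longrightarrow> (\<exists>c. v = c \<cdot>\<^sub>v u))"

lemma lower_block_carrier [simp]:
  "A \<in> carrier_mat (Suc n) (Suc n) \<Longrightarrow> lower_block A \<in> carrier_mat n n"
  by (auto simp: lower_block_def)

lemma lower_block_index [simp]:
  "A \<in> carrier_mat (Suc n) (Suc n) \<Longrightarrow> i < n \<Longrightarrow> j < n \<Longrightarrow> lower_block A $$ (i, j) = A $$ (Suc i, Suc j)"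
  by (auto simp: lower_block_def)

lemma lower_block_add:
  assumes "A \<in> carrier_mat (Suc n) (Suc n)" "B \<in> carrier_mat (Suc n) (Suc n)"
  shows "lower_block (A + B) = lower_block A + lower_block B"
  using assms by (auto simp: lower_block_def intro!: eq_matI)

lemma lower_block_smult: "lower_block (c \<cdot>\<^sub>m A) = c \<cdot>\<^sub>m lower_block A"
  by (auto simp: lower_block_def intro!: eq_matI)

lemma lower_block_zero: "lower_block (0\<^sub>m (Suc n) (Suc n)) = 0\<^sub>m n n"
  by (auto simp: lower_block_def intro!: eq_matI)

lemma lower_block_jordan_block: "lower_block (jordan_block (Suc n) a) = jordan_block n a"
  by (auto simp: lower_block_def intro!: eq_matI)

abbreviation vec_tail :: "nat \<Rightarrow> 'a vec \<Rightarrow> 'a vec" where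
  "vec_tail n x \<equiv> vec n (\<lambda>i. x $ Suc i)"

text \<open>A vector v in the kernel of the lower block lifts to x = (0, v), and \<open>A\<close>
  sends x to r \<bullet> v times the first unit vector. The kernel of \<open>A\<close> is the line
  of that unit vector, so A x = 0 only if v = 0. Thus v \<mapsto> r \<bullet> v is injective on the
  kernel of the block, which is therefore at most a line.\<close>

lemma regular_nilpotent_lower_block:
  fixes A :: "'a::field mat"
  assumes reg: "regular_nilpotent (Suc n) A" and col: "\<And>i. i < Suc n \<Longrightarrow> A $$ (i, 0) = 0"
  shows "regular_nilpotent n (lower_block A)"
proof -
  have A: "A \<in> carrier_mat (Suc n) (Suc n)" using reg by (simp add: regular_nilpotent_def)
  have L: "lower_block A \<in> carrier_mat n n" using A by simp
  note [simp] = carrier_matD[OF L]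
  have mult: "(A *\<^sub>v x) $ i = (\<Sum>j<n. A $$ (i, Suc j) * x $ Suc j)"
    if "i < Suc n" "x \<in> carrier_vec (Suc n)" for i x
    using that A col[OF that(1)] by (simp add: scalar_prod_def sum.lessThan_Suc_shift atLeast0LessThan del: sum.lessThan_Suc)
  have tail: "vec_tail n (A *\<^sub>v x) = lower_block A *\<^sub>v vec_tail n x"
    if x: "x \<in> carrier_vec (Suc n)" for x
  proof (rule eq_vecI)
    fix i assume "i < dim_vec (lower_block A *\<^sub>v vec_tail n x)"
    then have i: "i < n" using L by simp
    have "vec_tail n (A *\<^sub>v x) $ i = (\<Sum>j<n. A $$ (Suc i, Suc j) * x $ Suc j)"
      using mult[OF _ x, of "Suc i"] i by simp
    then show "vec_tail n (A *\<^sub>v x) $ i = (lower_block A *\<^sub>v vec_tail n x) $ i"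
      using i A L by (simp add: scalar_prod_def atLeast0LessThan)
  qed (use L in simp)
  have tail_iter: "vec_tail n (iter A k x) = iter (lower_block A) k (vec_tail n x)"
    if x: "x \<in> carrier_vec (Suc n)" for x k
    by (induction k) (use A x tail iter_carrier[OF A x] in auto)
  have tail_cons: "vec_tail n (vCons a v) = v" if "v \<in> carrier_vec n" for a and v :: "'a vec"
    using that by (auto intro!: eq_vecI)
  have cons: "vCons a v \<in> carrier_vec (Suc n)" if "v \<in> carrier_vec n" for a and v :: "'a vec"
    using that by simp
  have "nilpotent_mat (lower_block A)"
  proof -
    obtain k where k: "\<And>x. x \<in> carrier_vec (Suc n) \<Longrightarrow> iter A k x = 0\<^sub>v (Suc n)"
      using reg nilpotent_mat_iff_iter[OF A] by (auto simp: regular_nilpotent_def)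
    have "iter (lower_block A) k v = 0\<^sub>v n" if v: "v \<in> carrier_vec n" for v
    proof -
      have "iter (lower_block A) k v = vec_tail n (iter A k (vCons 0 v))"
        using tail_iter[OF cons[OF v]] tail_cons[OF v] by simp
      then show ?thesis using k[OF cons[OF v]] by (auto intro!: eq_vecI)
    qed
    then show ?thesis using nilpotent_mat_iff_iter[OF L] by blast
  qed
  moreover have "\<exists>u. \<forall>v\<in>carrier_vec n. lower_block A *\<^sub>v v = 0\<^sub>v n \<longrightarrow> (\<exists>c. v = c \<cdot>\<^sub>v u)"
  proof -
    obtain u where u: "\<And>x. x \<in> carrier_vec (Suc n) \<Longrightarrow> A *\<^sub>v x = 0\<^sub>v (Suc n) \<Longrightarrow> \<exists>c. x = c \<cdot>\<^sub>v u"
      using reg by (auto simp: regular_nilpotent_def)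
    have "A *\<^sub>v unit_vec (Suc n) 0 = 0\<^sub>v (Suc n)"
      using A mult[of _ "unit_vec (Suc n) 0"] by (auto intro!: eq_vecI)
    then obtain c0 where c0: "(unit_vec (Suc n) 0 :: 'a vec) = c0 \<cdot>\<^sub>v u"
      using u[OF unit_vec_carrier] by blast
    have du: "dim_vec u = Suc n" using arg_cong[OF c0, of dim_vec] by simp
    have "c0 * u $ 0 = 1" using arg_cong[OF c0, of "\<lambda>x. x $ 0"] du by simp
    then have c00: "c0 \<noteq> 0" by auto
    have utail: "u $ Suc i = 0" if "i < n" for i
      using arg_cong[OF c0, of "\<lambda>x. x $ Suc i"] du that c00 by simp
    have ker: "v = 0\<^sub>v n" if v: "v \<in> carrier_vec n" "A *\<^sub>v vCons 0 v = 0\<^sub>v (Suc n)" for v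
    proof -
      obtain c where c: "vCons 0 v = c \<cdot>\<^sub>v u" using u[OF cons[OF v(1)] v(2)] by blast
      have "v $ i = 0" if "i < n" for i
        using arg_cong[OF c, of "\<lambda>x. x $ Suc i"] utail that du by simp
      then show ?thesis using v by (auto intro!: eq_vecI)
    qed
    define r where "r = vec n (\<lambda>j. A $$ (0, Suc j))"
    have r: "r \<in> carrier_vec n" by (simp add: r_def)
    have Acons: "A *\<^sub>v vCons 0 v = vCons (r \<bullet> v) (lower_block A *\<^sub>v v)" if v: "v \<in> carrier_vec n" for v
    proof (rule eq_vecI)
      fix i assume "i < dim_vec (vCons (r \<bullet> v) (lower_block A *\<^sub>v v))"
      then have "i < Suc n" using L by simp
      then show "(A *\<^sub>v vCons 0 v) $ i = vCons (r \<bullet> v) (lower_block A *\<^sub>v v) $ i"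
        using v A L mult[OF _ cons[OF v], of i]
        by (cases i) (auto simp: r_def scalar_prod_def atLeast0LessThan)
    qed (use A L in auto)
    show ?thesis
    proof (cases "\<exists>v0\<in>carrier_vec n. lower_block A *\<^sub>v v0 = 0\<^sub>v n \<and> r \<bullet> v0 \<noteq> 0")
      case True
      then obtain v0 where v0: "v0 \<in> carrier_vec n" "lower_block A *\<^sub>v v0 = 0\<^sub>v n" "r \<bullet> v0 \<noteq> 0"
        by blast
      have "\<exists>c. v = c \<cdot>\<^sub>v v0" if v: "v \<in> carrier_vec n" "lower_block A *\<^sub>v v = 0\<^sub>v n" for v
      proof -
        \<comment> \<open>With this c, both the lower block and \<open>r\<close> annihilate v - c
          v0, so injectivity gives v = c v0.\<close>
        define c where "c = (r \<bullet> v) / (r \<bullet> v0)"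
        have d: "v - c \<cdot>\<^sub>v v0 \<in> carrier_vec n" using v v0 by simp
        have "lower_block A *\<^sub>v (v - c \<cdot>\<^sub>v v0) = 0\<^sub>v n"
          using v v0 L
          by (auto simp: mult_minus_distrib_mat_vec[OF L] mult_mat_vec[OF L] intro!: eq_vecI)
        moreover have "r \<bullet> (v - c \<cdot>\<^sub>v v0) = 0"
          using v v0 r by (simp add: scalar_prod_minus_distrib[of _ n] c_def)
        ultimately have "A *\<^sub>v vCons 0 (v - c \<cdot>\<^sub>v v0) = 0\<^sub>v (Suc n)"
          using Acons[OF d] by (simp add: zero_vec_Suc)
        then have "v - c \<cdot>\<^sub>v v0 = 0\<^sub>v n" using ker d by blast
        then have "(v - c \<cdot>\<^sub>v v0) $ i = 0" if "i < n" for i using that by simp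
        then have "v $ i = c * v0 $ i" if "i < n" for i using that v v0 by simp
        then have "v = c \<cdot>\<^sub>v v0" using v v0 by (auto intro!: eq_vecI)
        then show ?thesis ..
      qed
      then show ?thesis by blast
    next
      case False
      have "v = 0 \<cdot>\<^sub>v 0\<^sub>v n" if v: "v \<in> carrier_vec n" "lower_block A *\<^sub>v v = 0\<^sub>v n" for v
      proof -
        have "A *\<^sub>v vCons 0 v = 0\<^sub>v (Suc n)" using Acons[OF v(1)] v False by (auto simp: zero_vec_Suc)
        then have "v = 0\<^sub>v n" using ker v(1) by blast
        then show ?thesis by (auto intro!: eq_vecI)
      qed
      then show ?thesis by blast
    qed
  qed
  ultimately show ?thesis using L by (simp add: regular_nilpotent_def)
qed

section \<open>The dimension bound\<close>

definition linear_functional :: "nat \<Rightarrow> ('a::field mat \<Rightarrow> 'a) \<Rightarrow> bool" where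
  "linear_functional n f \<longleftrightarrow>
    (\<forall>A\<in>carrier_mat n n. \<forall>B\<in>carrier_mat n n. f (A + B) = f A + f B) \<and>
    (\<forall>c. \<forall>A\<in>carrier_mat n n. f (c \<cdot>\<^sub>m A) = c * f A)"

text \<open>For a subspace \<open>Z\<close> this says that \<open>Z\<close> has dimension at most \<open>d\<close>, without mentioning bases.\<close>

definition separated_by :: "nat \<Rightarrow> 'a::field mat set \<Rightarrow> nat \<Rightarrow> bool" where
  "separated_by n Z d \<longleftrightarrow> (\<exists>F. finite F \<and> card F \<le> d \<and> (\<forall>f\<in>F. linear_functional n f) \<and>
    (\<forall>A\<in>Z. (\<forall>f\<in>F. f A = 0) \<longrightarrow> A = 0\<^sub>m n n))"

lemma linear_functional_entry:
  "i < n \<Longrightarrow> j < n \<Longrightarrow> linear_functional n (\<lambda>A. A $$ (i, j))"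
  by (auto simp: linear_functional_def)

lemma linear_functional_row:
  assumes "i < n" "u \<in> carrier_vec n"
  shows "linear_functional n (\<lambda>A. row A i \<bullet> u)"
  using assms by (auto simp: linear_functional_def add_scalar_prod_distrib[of _ n])

lemma linear_functional_lower_block:
  assumes "linear_functional n f"
  shows "linear_functional (Suc n) (f \<circ> lower_block)"
  using assms by (auto simp: linear_functional_def lower_block_add lower_block_smult)

text \<open>Otherwise the kernel of \<open>jordan_block n 0 + c \<cdot>\<^sub>m B\<close> is two-dimensional for some \<open>c\<close>.\<close>

lemma regular_nilpotent_first_row:
  fixes B :: "'a::field mat"
  assumes n: "2 \<le> n" and B: "B \<in> carrier_mat n n"
    and C_mult: "\<And>v. v \<in> carrier_vec n \<Longrightarrow> B *\<^sub>v v = (row B 0 \<bullet> v) \<cdot>\<^sub>v unit_vec n 0"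
    and B00: "B $$ (0, 0) = 0"
    and reg: "\<And>c. regular_nilpotent n (jordan_block n 0 + c \<cdot>\<^sub>m B)"
  shows "B $$ (0, 1) = 0"
proof (rule ccontr)
  assume b: "B $$ (0, 1) \<noteq> 0"
  \<comment> \<open>Then c times the entry (0, 1) is -1 and cancels the superdiagonal one in column
    1, so that \<open>A\<close> kills both \<open>unit_vec n 0\<close> and
    \<open>unit_vec n 1\<close>.\<close>
  define c where "c = - inverse (B $$ (0, 1))"
  define A where "A = jordan_block n 0 + c \<cdot>\<^sub>m B"
  obtain u where u: "\<And>v. v \<in> carrier_vec n \<Longrightarrow> A *\<^sub>v v = 0\<^sub>v n \<Longrightarrow> \<exists>c. v = c \<cdot>\<^sub>v u"
    using reg[of c] unfolding regular_nilpotent_def A_def by blast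
  have mult: "A *\<^sub>v unit_vec n j = jordan_block n 0 *\<^sub>v unit_vec n j + (c * B $$ (0, j)) \<cdot>\<^sub>v unit_vec n 0"
    if "j < n" for j
    using that n B unfolding A_def
    by (simp add: add_mult_distrib_mat_vec[of _ n n] smult_mat_mult_vec[of _ n n] C_mult
        smult_smult_assoc)
  have J: "(jordan_block n 0 *\<^sub>v unit_vec n j) $ i = (if Suc i = j then 1 else (0::'a))"
    if "i < n" "j < n" for i j
    using that jordan_block_iter[of "unit_vec n j" n i 1] by auto
  have "A *\<^sub>v unit_vec n 0 = 0\<^sub>v n"
    by (rule eq_vecI) (use n B mult[of 0] J B00 in auto)
  then obtain c0 where c0: "(unit_vec n 0 :: 'a vec) = c0 \<cdot>\<^sub>v u"
    using u[OF unit_vec_carrier] by blast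
  have "A *\<^sub>v unit_vec n 1 = 0\<^sub>v n"
    by (rule eq_vecI) (use n B mult[of 1] J b in \<open>auto simp: c_def\<close>)
  then obtain c1 where c1: "(unit_vec n 1 :: 'a vec) = c1 \<cdot>\<^sub>v u"
    using u[OF unit_vec_carrier] by blast
  have du: "dim_vec u = n" using arg_cong[OF c0, of dim_vec] by simp
  have "c0 * u $ 0 = 1" "c0 * u $ 1 = 0" "c1 * u $ 1 = 1"
    using arg_cong[OF c0, of "\<lambda>x. x $ 0"] arg_cong[OF c0, of "\<lambda>x. x $ 1"]
      arg_cong[OF c1, of "\<lambda>x. x $ 1"] du n by auto
  then show False by auto
qed

text \<open>\<open>F\<close> consists of matrix entries that detect the first column and of pairings
  of the first row with fixed vectors. The entries are enough to force B e = 0; the pairings then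
  detect the matrices e y^T that remain once the lower block vanishes as well.\<close>

lemma first_column_and_row_separated:
  fixes Z :: "'a::field mat set"
  assumes n: "2 \<le> n" and K: "infinite (UNIV :: 'a set) \<or> n < card (UNIV :: 'a set)"
    and Z: "Z \<subseteq> carrier_mat n n" and Z0: "0\<^sub>m n n \<in> Z"
    and Zadd: "\<And>A B. A \<in> Z \<Longrightarrow> B \<in> Z \<Longrightarrow> A + B \<in> Z"
    and Zsmult: "\<And>c A. A \<in> Z \<Longrightarrow> c \<cdot>\<^sub>m A \<in> Z"
    and reg: "\<And>B. B \<in> Z \<Longrightarrow> regular_nilpotent n (jordan_block n 0 + B)"
  obtains F where "finite F" "card F \<le> n - 2" "\<And>f. f \<in> F \<Longrightarrow> linear_functional n f"
    "\<And>B i. B \<in> Z \<Longrightarrow> (\<And>f. f \<in> F \<Longrightarrow> f B = 0) \<Longrightarrow> i < n \<Longrightarrow> B $$ (i, 0) = 0"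
    "\<And>B. B \<in> Z \<Longrightarrow> (\<And>f. f \<in> F \<Longrightarrow> f B = 0) \<Longrightarrow> lower_block B = 0\<^sub>m (n - 1) (n - 1) \<Longrightarrow> B = 0\<^sub>m n n"
proof -
  interpret vec_space "TYPE('a)" n .
  define J where "J = jordan_block n (0::'a)"
  define e where "e = (unit_vec n 0 :: 'a vec)"
  have J: "J \<in> carrier_mat n n" by (simp add: J_def)
  have e: "e \<in> carrier_vec n" by (simp add: e_def)
  have e0: "e \<noteq> 0\<^sub>v n" using n by (simp add: e_def)
  have Je: "J *\<^sub>v e = 0\<^sub>v n"
    by (rule eq_vecI) (use jordan_block_iter[OF e, of _ 1] in \<open>auto simp: J_def e_def\<close>)
  have ZB: "B \<in> carrier_mat n n" if "B \<in> Z" for B using that Z by blast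
  have JB: "J + B \<in> carrier_mat n n" "nilpotent_mat (J + B)" if "B \<in> Z" for B
    using reg[OF that] by (simp_all add: regular_nilpotent_def J_def)
  define p where "p = (LEAST k. \<forall>B\<in>Z. iter (J + B) k e = 0\<^sub>v n)"
  have pn: "\<forall>B\<in>Z. iter (J + B) n e = 0\<^sub>v n"
    using nilpotent_iter_dim[OF JB e] by blast
  have p: "\<forall>B\<in>Z. iter (J + B) p e = 0\<^sub>v n"
    unfolding p_def by (rule LeastI[of _ n]) (fact pn)
  have p_le: "p \<le> n" unfolding p_def by (rule Least_le) (fact pn)
  have "p \<noteq> 0" using p Z0 e0 by (metis funpow_0)
  then obtain m where m: "p = Suc m" by (cases p) auto
  \<comment> \<open>By minimality of p = m + 1, some \<open>B0\<close> in \<open>Z\<close> has a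
    Krylov chain of the full length p.\<close>
  have "\<not> (\<forall>B\<in>Z. iter (J + B) m e = 0\<^sub>v n)"
    using not_less_Least[of m "\<lambda>k. \<forall>B\<in>Z. iter (J + B) k e = 0\<^sub>v n"] m by (simp add: p_def)
  then obtain B0 where B0: "B0 \<in> Z" "iter (J + B0) m e \<noteq> 0\<^sub>v n" by blast
  have col: "B $$ (i, 0) = 0" if B: "B \<in> Z" and i: "m \<le> i" "i < n" for B i
  proof -
    \<comment> \<open>J^m shifts entries up by m, so J^m B e = 0 clears all entries of B e from
      index m on.\<close>
    have "iter J m (B *\<^sub>v e) = 0\<^sub>v n"
    proof (rule iter_pencil_zero[OF J ZB[OF B] e Je])
      show "infinite (UNIV :: 'a set) \<or> Suc m < card (UNIV :: 'a set)" using K p_le m by auto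
      show "iter (J + t \<cdot>\<^sub>m B) (Suc m) e = 0\<^sub>v n" for t using p Zsmult[OF B] m by blast
    qed
    moreover have "iter J m (B *\<^sub>v e) $ (i - m) = (B *\<^sub>v e) $ i"
      using jordan_block_iter[of "B *\<^sub>v e" n "i - m" m] ZB[OF B] i by (simp add: J_def e_def)
    ultimately show ?thesis using ZB[OF B] i n by (simp add: e_def)
  qed
  \<comment> \<open>The row y of a matrix e y^T in \<open>Z\<close> will be orthogonal to
    \<open>T\<close>. If m = 0, the Krylov chain is just e, and the second unit vector is added so
    that at most n - 2 rather than n - 1 pairings remain.\<close>
  define T where "T = (if m = 0 then {unit_vec n 0, unit_vec n 1} else (\<lambda>k. iter (J + B0) k e) ` {..<p})"
  have T: "T \<subseteq> carrier_vec n" "finite T"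
    using iter_carrier[OF JB(1)[OF B0(1)] e] by (auto simp: T_def)
  have T_li: "lin_indpt T" and T_card: "card T = (if m = 0 then 2 else p)"
  proof -
    have "lin_indpt T \<and> card T = (if m = 0 then 2 else p)"
    proof (cases "m = 0")
      case True
      have "lin_indpt (set (unit_vecs n))" using unit_vecs_basis by (simp add: basis_def)
      moreover have "{unit_vec n 0, unit_vec n 1} \<subseteq> set (unit_vecs n)"
        using n by (auto simp: unit_vecs_def)
      ultimately have "lin_indpt {unit_vec n 0, unit_vec n 1}" by (rule subset_li_is_li)
      moreover have "unit_vec n 0 \<noteq> (unit_vec n 1 :: 'a vec)"
        using n by (simp add: unit_vec_eq)
      ultimately show ?thesis using True by (simp add: T_def)
    next
      case False
      have "iter (J + B0) q e \<noteq> 0\<^sub>v n" if "q < p" for q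
        using iter_mono_zero[OF JB(1)[OF B0(1)], of q e m] B0(2) that m by auto
      then show ?thesis
        using krylov_lin_indpt[OF JB(1)[OF B0(1)] e, of p] p B0(1) False by (simp add: T_def)
    qed
    then show "lin_indpt T" "card T = (if m = 0 then 2 else p)" by auto
  qed
  obtain C where C: "finite C" "C \<subseteq> carrier_vec n" "card C + card T \<le> n"
    "\<And>y. y \<in> carrier_vec n \<Longrightarrow> (\<And>u. u \<in> T \<union> C \<Longrightarrow> y \<bullet> u = 0) \<Longrightarrow> y = 0\<^sub>v n"
    using orthogonal_extension[OF T T_li] by blast
  \<comment> \<open>Column entries from m on vanish by \<open>col\<close>, and entry (0, 0) will
    vanish by nilpotency. For m > 0 this leaves m - 1 = p - 2 entries and at most n - p pairings;
    for m = 0, no entries and at most n - 2 pairings.\<close>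
  define F where "F = (\<lambda>i B. B $$ (i, 0)) ` {1..<m} \<union> (\<lambda>u B. row B 0 \<bullet> u) ` C"
  have col0: "B $$ (i, 0) = 0" if B: "B \<in> Z" and F0: "\<And>f. f \<in> F \<Longrightarrow> f B = 0" and i: "i < n" for B i
  proof -
    have pos: "B $$ (k, 0) = 0" if k: "0 < k" "k < n" for k
    proof (cases "k < m")
      case True
      then have "(\<lambda>B. B $$ (k, 0)) \<in> F" using k by (auto simp: F_def)
      then show ?thesis using F0 by blast
    qed (use col[OF B] k in simp)
    \<comment> \<open>Only the entry (0, 0) can be nonzero, so e is an eigenvector of J + B, whose
      eigenvalue is zero by nilpotency.\<close>
    have Be: "B *\<^sub>v e = B $$ (0, 0) \<cdot>\<^sub>v e"
      by (rule eq_vecI) (use ZB[OF B] pos n in \<open>auto simp: e_def\<close>)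
    have "(J + B) *\<^sub>v e = B $$ (0, 0) \<cdot>\<^sub>v e"
      using J ZB[OF B] e by (simp add: add_mult_distrib_mat_vec[of _ n n] Je Be)
    then have "B $$ (0, 0) = 0"
      using nilpotent_eigenvalue_zero[OF JB[OF B] e e0] by blast
    then show ?thesis using pos i by (cases "i = 0") auto
  qed
  show ?thesis
  proof (rule that[of F])
    show "finite F" using C by (simp add: F_def)
    have "card F \<le> card ((\<lambda>i (B::'a mat). B $$ (i, 0)) ` {1..<m}) + card ((\<lambda>u B. row B 0 \<bullet> u) ` C)"
      unfolding F_def by (rule card_Un_le)
    also have "\<dots> \<le> card {1..<m} + card C"
      by (intro add_mono card_image_le) (use C in auto)
    also have "\<dots> \<le> n - 2" using C(3) T_card m p_le n by (auto split: if_splits)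
    finally show "card F \<le> n - 2" .
    show "linear_functional n f" if "f \<in> F" for f
      using that n C p_le m by (auto simp: F_def intro!: linear_functional_entry linear_functional_row)
    show "B $$ (i, 0) = 0" if "B \<in> Z" "\<And>f. f \<in> F \<Longrightarrow> f B = 0" "i < n" for B i
      using col0 that by blast
    show "B = 0\<^sub>m n n"
      if B: "B \<in> Z" and F0: "\<And>f. f \<in> F \<Longrightarrow> f B = 0" and L: "lower_block B = 0\<^sub>m (n - 1) (n - 1)" for B
    proof -
      define y where "y = row B 0"
      have Bc: "B \<in> carrier_mat n n" by (rule ZB[OF B])
      have y: "y \<in> carrier_vec n" using n by (simp add: y_def row_carrier_vec[OF _ Bc])
      have c0: "B $$ (i, 0) = 0" if "i < n" for i using col0 B F0 that by blast
      have row0: "B $$ (i, j) = 0" if i: "0 < i" "i < n" and j: "j < n" for i j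
      proof (cases "j = 0")
        case False
        have "lower_block B $$ (i - 1, j - 1) = B $$ (i, j)"
          using Bc i j False by (simp add: lower_block_def)
        then show ?thesis using L i j False by simp
      qed (use c0 i in simp)
      \<comment> \<open>With the first column and the lower block zero, B = e y^T.\<close>
      have Bv: "B *\<^sub>v v = (y \<bullet> v) \<cdot>\<^sub>v e" if v: "v \<in> carrier_vec n" for v
      proof (rule eq_vecI)
        fix i assume "i < dim_vec ((y \<bullet> v) \<cdot>\<^sub>v e)"
        then have i: "i < n" by (simp add: e_def)
        show "(B *\<^sub>v v) $ i = ((y \<bullet> v) \<cdot>\<^sub>v e) $ i"
        proof (cases "i = 0")
          case False
          then have "row B i = 0\<^sub>v n" using row0 i Bc by (auto intro!: eq_vecI)
          then show ?thesis using i False Bc v by (simp add: e_def)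
        qed (use Bc i v in \<open>simp add: y_def e_def\<close>)
      qed (use Bc e in simp)
      have "y \<bullet> u = 0" if "u \<in> T" for u
      proof (cases "m = 0")
        case True
        have y0: "B $$ (0, 0) = 0" using c0 n by simp
        have "B $$ (0, 1) = 0"
        proof (rule regular_nilpotent_first_row[OF n Bc _ y0])
          show "B *\<^sub>v v = (row B 0 \<bullet> v) \<cdot>\<^sub>v unit_vec n 0" if "v \<in> carrier_vec n" for v
            using Bv[OF that] by (simp add: y_def e_def)
          show "regular_nilpotent n (jordan_block n 0 + c \<cdot>\<^sub>m B)" for c
            by (rule reg[OF Zsmult[OF B]])
        qed
        moreover have "u = unit_vec n 0 \<or> u = unit_vec n 1"
          using \<open>u \<in> T\<close> True by (simp add: T_def)
        ultimately show ?thesis using y0 y n Bc by (auto simp: y_def)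
      next
        case False
        then obtain k where k: "u = iter (J + B0) k e" using \<open>u \<in> T\<close> by (auto simp: T_def)
        \<comment> \<open>Both \<open>J + B0\<close> and its rank-one perturbation by B lie in J + Z
          and are nilpotent, so y is orthogonal to the whole Krylov chain of
          \<open>J + B0\<close>.\<close>
        have "J + B0 + B = J + (B0 + B)"
          by (rule assoc_add_mat[OF J ZB[OF B0(1)] Bc])
        then have nil: "nilpotent_mat (J + B0 + B)" using JB(2)[OF Zadd[OF B0(1) B]] by simp
        show ?thesis
          unfolding k
          by (rule nilpotent_rank_one_perturbation[OF JB(1)[OF B0(1)] Bc e y Bv JB(2)[OF B0(1)] nil])
      qed
      moreover have "y \<bullet> u = 0" if "u \<in> C" for u
      proof -
        have "(\<lambda>B. row B 0 \<bullet> u) \<in> F" using that by (auto simp: F_def)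
        from F0[OF this] show ?thesis by (simp add: y_def)
      qed
      ultimately have "y = 0\<^sub>v n" using C(4) y by blast
      then have first: "B $$ (0, j) = 0" if "j < n" for j
        using index_row(1)[of 0 B j] that Bc n by (simp add: y_def)
      show ?thesis
      proof (rule eq_matI)
        fix i j assume "i < dim_row (0\<^sub>m n n)" "j < dim_col (0\<^sub>m n n)"
        then show "B $$ (i, j) = 0\<^sub>m n n $$ (i, j)"
          using first[of j] row0[of i j] by (cases "i = 0") simp_all
      qed (use Bc in simp_all)
    qed
  qed
qed

text \<open>Induction on n. For size 1, nilpotency forces the matrix to be zero. For size n + 2, the
  first column and row cost n functionals and the lower right blocks n(n-1)/2 by induction, together
  (n+1)n/2.\<close>

theorem regular_nilpotent_affine_separated:
  fixes Z :: "'a::field mat set"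
  assumes "infinite (UNIV :: 'a set) \<or> Suc n < card (UNIV :: 'a set)"
    and "Z \<subseteq> carrier_mat (Suc n) (Suc n)" and "0\<^sub>m (Suc n) (Suc n) \<in> Z"
    and "\<And>A B. A \<in> Z \<Longrightarrow> B \<in> Z \<Longrightarrow> A + B \<in> Z"
    and "\<And>c A. A \<in> Z \<Longrightarrow> c \<cdot>\<^sub>m A \<in> Z"
    and "\<And>B. B \<in> Z \<Longrightarrow> regular_nilpotent (Suc n) (jordan_block (Suc n) 0 + B)"
  shows "separated_by (Suc n) Z (n * (n - 1) div 2)"
  using assms
proof (induction n arbitrary: Z)
  case 0
  have "B = 0\<^sub>m 1 1" if B: "B \<in> Z" for B
  proof -
    have Bc: "B \<in> carrier_mat 1 1" using B 0 by auto
    have "jordan_block 1 0 + B = B" using Bc by (auto intro!: eq_matI)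
    then have nil: "nilpotent_mat B" using 0(6)[OF B] by (simp add: regular_nilpotent_def)
    have "B *\<^sub>v unit_vec 1 0 = B $$ (0, 0) \<cdot>\<^sub>v unit_vec 1 0"
      using Bc by (auto intro!: eq_vecI)
    moreover have "unit_vec 1 0 \<noteq> (0\<^sub>v 1 :: 'a vec)" by simp
    ultimately have "B $$ (0, 0) = 0"
      using nilpotent_eigenvalue_zero[OF Bc nil unit_vec_carrier] by blast
    then show ?thesis using Bc by (auto intro!: eq_matI)
  qed
  then show ?case by (auto simp: separated_by_def intro!: exI[of _ "{}"])
next
  case (Suc n)
  let ?N = "Suc (Suc n)"
  obtain F where F: "finite F" "card F \<le> n" "\<And>f. f \<in> F \<Longrightarrow> linear_functional ?N f"
    "\<And>B i. B \<in> Z \<Longrightarrow> (\<And>f. f \<in> F \<Longrightarrow> f B = 0) \<Longrightarrow> i < ?N \<Longrightarrow> B $$ (i, 0) = 0"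
    "\<And>B. B \<in> Z \<Longrightarrow> (\<And>f. f \<in> F \<Longrightarrow> f B = 0) \<Longrightarrow> lower_block B = 0\<^sub>m (Suc n) (Suc n) \<Longrightarrow> B = 0\<^sub>m ?N ?N"
    using first_column_and_row_separated[of ?N Z] Suc.prems by auto
  have ZB: "B \<in> carrier_mat ?N ?N" if "B \<in> Z" for B using that Suc.prems by blast
  \<comment> \<open>For B with zero first column, the lower block of J + B is again regular
    nilpotent, so the induction hypothesis applies to the blocks of this subspace.\<close>
  define Z1 where "Z1 = {B \<in> Z. \<forall>i<?N. B $$ (i, 0) = 0}"
  have "separated_by (Suc n) (lower_block ` Z1) (n * (n - 1) div 2)"
  proof (rule Suc.IH)
    show "infinite (UNIV :: 'a set) \<or> Suc n < card (UNIV :: 'a set)" using Suc.prems(1) by auto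
    show "lower_block ` Z1 \<subseteq> carrier_mat (Suc n) (Suc n)" using ZB by (auto simp: Z1_def)
    have "0\<^sub>m ?N ?N \<in> Z1" using Suc.prems(3) by (simp add: Z1_def)
    then show "0\<^sub>m (Suc n) (Suc n) \<in> lower_block ` Z1" by (metis imageI lower_block_zero)
    show "A + B \<in> lower_block ` Z1" if im: "A \<in> lower_block ` Z1" "B \<in> lower_block ` Z1" for A B
    proof -
      obtain A' B' where AB: "A' \<in> Z1" "B' \<in> Z1" "A = lower_block A'" "B = lower_block B'"
        using im by blast
      have "A' \<in> carrier_mat ?N ?N" "B' \<in> carrier_mat ?N ?N" using AB ZB by (auto simp: Z1_def)
      then have "A' + B' \<in> Z1" "lower_block (A' + B') = A + B"
        using AB Suc.prems(4) by (auto simp: Z1_def lower_block_add)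
      then show ?thesis by (metis imageI)
    qed
    show "c \<cdot>\<^sub>m A \<in> lower_block ` Z1" if im: "A \<in> lower_block ` Z1" for c A
    proof -
      obtain A' where A: "A' \<in> Z1" "A = lower_block A'" using im by blast
      have "A' \<in> carrier_mat ?N ?N" using A ZB by (auto simp: Z1_def)
      then have "c \<cdot>\<^sub>m A' \<in> Z1" using A Suc.prems(5) by (auto simp: Z1_def)
      then show ?thesis using A by (metis imageI lower_block_smult)
    qed
    show "regular_nilpotent (Suc n) (jordan_block (Suc n) 0 + B)" if im: "B \<in> lower_block ` Z1" for B
    proof -
      obtain B' where B: "B' \<in> Z" "\<And>i. i < ?N \<Longrightarrow> B' $$ (i, 0) = 0" "B = lower_block B'"
        using im by (auto simp: Z1_def)
      have "regular_nilpotent (Suc n) (lower_block (jordan_block ?N 0 + B'))"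
        using Suc.prems(6)[OF B(1)] ZB[OF B(1)] B(2)
        by (intro regular_nilpotent_lower_block) auto
      then show ?thesis
        using ZB[OF B(1)] B(3) by (simp add: lower_block_add[of _ "Suc n"] lower_block_jordan_block)
    qed
  qed
  then obtain G where G: "finite G" "card G \<le> n * (n - 1) div 2"
    "\<forall>g\<in>G. linear_functional (Suc n) g"
    "\<forall>A\<in>lower_block ` Z1. (\<forall>g\<in>G. g A = 0) \<longrightarrow> A = 0\<^sub>m (Suc n) (Suc n)"
    unfolding separated_by_def by (elim exE conjE)
  show ?case
    unfolding separated_by_def
  proof (intro exI[of _ "F \<union> (\<lambda>g. g \<circ> lower_block) ` G"] conjI ballI impI)
    have "card (F \<union> (\<lambda>g. g \<circ> lower_block) ` G) \<le> card F + card ((\<lambda>g. g \<circ> lower_block) ` G)"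
      by (rule card_Un_le)
    also have "\<dots> \<le> n + n * (n - 1) div 2"
      using F(2) G(2) card_image_le[OF G(1), of "\<lambda>g. g \<circ> lower_block"] by linarith
    also have "\<dots> = (n * (n - 1) + n * 2) div 2" by simp
    also have "n * (n - 1) + n * 2 = Suc n * (Suc n - 1)" by (cases n) auto
    finally show "card (F \<union> (\<lambda>g. g \<circ> lower_block) ` G) \<le> Suc n * (Suc n - 1) div 2" .
    \<comment> \<open>Vanishing of the functionals in \<open>F\<close> first puts B into
      \<open>Z1\<close>, so that those in \<open>G\<close> apply to its lower block; once the block
      is zero, \<open>F\<close> forces B = 0.\<close>
    fix B assume B: "B \<in> Z" and z: "\<forall>f\<in>F \<union> (\<lambda>g. g \<circ> lower_block) ` G. f B = 0"
    then have "B \<in> Z1" using F(4) by (auto simp: Z1_def)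
    moreover have "\<forall>g\<in>G. g (lower_block B) = 0" using z by (simp add: ball_Un)
    ultimately have "lower_block B = 0\<^sub>m (Suc n) (Suc n)" using G(4) by blast
    then show "B = 0\<^sub>m ?N ?N" using F(5) B z by auto
  qed (use F(1,3) G(1,3) in \<open>auto intro: linear_functional_lower_block\<close>)
qed

section \<open>Dimensions and ranks\<close>

context linear_map
begin

lemma inj_lin_indpt_image:
  assumes inj: "inj_on T (carrier V)" and B: "finite B" "B \<subseteq> carrier V" "V.module.lin_indpt B"
  shows "W.module.lin_indpt (T ` B)"
proof (rule W.module.finite_lin_indpt2)
  fix a assume a: "a \<in> T ` B \<rightarrow> carrier K" and lc: "W.module.lincomb a (T ` B) = \<zero>\<^bsub>W\<^esub>"
  have aT: "a \<circ> T \<in> B \<rightarrow> carrier K" using a by auto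
  have "T (V.module.lincomb (a \<circ> T) B) = \<zero>\<^bsub>W\<^esub>"
    using lincomb_linear_image[OF inj B(2) a B(1)] lc by simp
  then have "V.module.lincomb (a \<circ> T) B = \<zero>\<^bsub>V\<^esub>"
    using inj aT B(2) by (metis V.module.M.zero_closed V.module.lincomb_closed f0_is_0 inj_onD)
  then have "a \<circ> T \<in> B \<rightarrow> {\<zero>\<^bsub>K\<^esub>}"
    using V.not_lindepD[OF B(3,1) subset_refl aT] by blast
  then show "\<forall>v\<in>T ` B. a v = \<zero>\<^bsub>K\<^esub>" by auto
qed (use B in auto)

text \<open>Independent sets of V embed into W, so their cardinality is bounded. Hence a maximal one
  exists; it is a finite basis, which gives both claims.\<close>

lemma inj_dim_le:
  assumes inj: "inj_on T (carrier V)" and fd: "W.fin_dim"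
  shows "V.fin_dim" "V.dim \<le> W.dim"
proof -
  have bound: "card B \<le> W.dim" if B: "finite B" "B \<subseteq> carrier V" "V.module.lin_indpt B" for B
  proof -
    have "T ` B \<subseteq> carrier W" using B(2) by auto
    then have "card (T ` B) \<le> W.dim"
      using W.li_le_dim(2)[OF fd _ inj_lin_indpt_image[OF inj B]] by blast
    then show ?thesis using card_image[of T B] inj B(2) by (metis inj_on_subset)
  qed
  have "finite B \<and> card B \<le> W.dim" if B: "B \<subseteq> carrier V \<and> V.module.lin_indpt B" for B
  proof -
    have "finite B"
    proof (rule ccontr)
      assume "infinite B"
      then obtain C where C: "C \<subseteq> B" "finite C" "card C = Suc W.dim"
        using infinite_arbitrarily_large by blast
      then have "V.module.lin_indpt C" using B V.module.subset_li_is_li by blast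
      then show False using bound[of C] C B by auto
    qed
    then show ?thesis using bound B by blast
  qed
  moreover have "{} \<subseteq> carrier V \<and> V.module.lin_indpt {}"
    using V.module.finite_lin_indpt2[of "{}"] by simp
  ultimately obtain A where A: "finite A" "maximal A (\<lambda>S. S \<subseteq> carrier V \<and> V.module.lin_indpt S)"
    using maximal_exists[of "\<lambda>S. S \<subseteq> carrier V \<and> V.module.lin_indpt S"] by blast
  have basis: "V.basis A" using V.max_li_is_basis[OF A(2)] .
  show "V.fin_dim" using basis A(1) unfolding V.fin_dim_def V.basis_def by blast
  show "V.dim \<le> W.dim"
    using V.dim_basis[OF A(1) basis] bound[OF A(1)] basis by (simp add: V.basis_def)
qed

end

section \<open>Rank and kernel of a square matrix\<close>

lemma linear_mapI:
  assumes "vectorspace K V" "vectorspace K W" "T \<in> LinearCombinations.module_hom K V W"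
  shows "linear_map K V W T"
  using assms by (simp add: linear_map_def mod_hom_def mod_hom_axioms_def vectorspace_def)

context vec_space
begin

lemma rank_plus_kernel_dim:
  fixes A :: "'a mat"
  assumes A: "A \<in> carrier_mat n n"
  shows "rank A + kernel.dim n A = n"
proof -
  have hom: "(*\<^sub>v) A \<in> LinearCombinations.module_hom class_ring V V"
    using A by (auto simp: LinearCombinations.module_hom_def module_vec_simps class_ring_simps
        mult_add_distrib_mat_vec[OF A] mult_mat_vec[OF A])
  interpret T: linear_map class_ring V V "(*\<^sub>v) A"
    by (rule linear_mapI[OF vec_vs vec_vs hom])
  have "T.im = col_space A"
    using A by (auto simp: T.im_def col_space_eq module_vec_simps)
  moreover have "T.ker = mat_kernel A"
    using A by (auto simp: T.ker_def mat_kernel module_vec_simps)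
  ultimately show ?thesis
    using T.rank_nullity[OF fin_dim] dim_is_n by (simp add: rank_def col_space_def)
qed

text \<open>By rank-nullity the kernel has dimension 1; this turns the rank condition into the
  kernel condition of \<open>regular_nilpotent\<close>.\<close>

lemma rank_kernel_line:
  fixes A :: "'a mat"
  assumes A: "A \<in> carrier_mat n n" and n: "0 < n" and r: "rank A = n - 1"
  shows "\<exists>u. \<forall>v\<in>carrier_vec n. A *\<^sub>v v = 0\<^sub>v n \<longrightarrow> (\<exists>c. v = c \<cdot>\<^sub>v u)"
proof -
  interpret K: kernel n n A by unfold_locales (fact A)
  have d: "K.dim = 1" using rank_plus_kernel_dim[OF A] r n by simp
  obtain B where B: "finite B" "K.basis B" using kernel_basis_exists[OF A] by blast
  have "card B = 1" using K.Ker.dim_basis[OF B] d by simp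
  then obtain u where u: "B = {u}" by (auto simp: card_1_singleton_iff)
  have uK: "{u} \<subseteq> mat_kernel A" and sp: "K.span {u} = mat_kernel A"
    using B(2) u by (auto simp: K.Ker.basis_def)
  have "\<exists>c. v = c \<cdot>\<^sub>v u" if "v \<in> carrier_vec n" "A *\<^sub>v v = 0\<^sub>v n" for v
  proof -
    have "v \<in> span {u}" using mat_kernelI[OF A that] sp K.span_same[OF uK] by simp
    moreover have "finite {u}" "{u} \<subseteq> carrier_vec n"
      using uK mat_kernel_carrier[OF A] by auto
    ultimately obtain a where "v = lincomb a {u}"
      using finite_in_span by metis
    moreover have "lincomb a {u} = a u \<cdot>\<^sub>v u"
      using \<open>{u} \<subseteq> carrier_vec n\<close> by (simp add: lincomb_def)
    ultimately show ?thesis by blast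
  qed
  then show ?thesis by blast
qed

text \<open>The converse passage from kernel to rank, for the extremal example.\<close>

lemma kernel_line_rank:
  fixes A :: "'a mat"
  assumes A: "A \<in> carrier_mat n n" and n: "0 < n"
    and u: "u \<in> carrier_vec n" "u \<noteq> 0\<^sub>v n" "A *\<^sub>v u = 0\<^sub>v n"
    and line: "\<And>v. v \<in> carrier_vec n \<Longrightarrow> A *\<^sub>v v = 0\<^sub>v n \<Longrightarrow> \<exists>c. v = c \<cdot>\<^sub>v u"
  shows "rank A = n - 1"
proof -
  interpret K: kernel n n A by unfold_locales (fact A)
  have uK: "u \<in> mat_kernel A" by (rule mat_kernelI[OF A u(1,3)])
  have "v \<in> K.span {u}" if v: "v \<in> mat_kernel A" for v
  proof -
    obtain c where "v = c \<cdot>\<^sub>v u" using line mat_kernelD[OF A v] by blast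
    then have "v \<in> span {u}" using smult_in_span[OF _ span_mem] u(1) by auto
    then show ?thesis using K.span_same uK by simp
  qed
  moreover have "K.span {u} \<subseteq> mat_kernel A"
    using K.Ker.span_closed[of "{u}"] uK by blast
  ultimately have "K.dim = 1"
    using K.Ker.dim1I[of u] uK u(2) by auto
  then show ?thesis using rank_plus_kernel_dim[OF A] by simp
qed

end

text \<open>Evaluation at the functionals is an injective linear map from \<open>Z\<close> to the
  vectors of length \<open>card F\<close>.\<close>

lemma separated_by_dim_le:
  fixes Z :: "'a::field mat set"
  assumes sub: "VectorSpace.subspace class_ring Z (mat_space TYPE('a) n)"
    and sep: "separated_by n Z d"
  shows "vectorspace.fin_dim class_ring ((mat_space TYPE('a) n)\<lparr>carrier := Z\<rparr>)"
    and "vectorspace.dim class_ring ((mat_space TYPE('a) n)\<lparr>carrier := Z\<rparr>) \<le> d"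
proof -
  let ?M = "mat_space TYPE('a) n"
  have Zvs: "vectorspace class_ring (?M\<lparr>carrier := Z\<rparr>)"
    by (rule vectorspace.subspace_is_vs[OF vectorspace_mat_space sub])
  have subm: "submodule class_ring Z ?M"
    using sub by (simp add: VectorSpace.subspace_def)
  have Zc: "Z \<subseteq> carrier_mat n n"
    using submodule.subset[OF subm] by (simp add: module_mat_simps)
  have Zclosed: "A + B \<in> Z" "c \<cdot>\<^sub>m A \<in> Z" if "A \<in> Z" "B \<in> Z" for A B c
    using submodule.m_closed[OF subm that] submodule.smult_closed[OF subm _ that(1), of c]
    by (simp_all add: module_mat_simps class_ring_simps)
  obtain F where F: "finite F" "card F \<le> d" "\<forall>f\<in>F. linear_functional n f"
    "\<forall>A\<in>Z. (\<forall>f\<in>F. f A = 0) \<longrightarrow> A = 0\<^sub>m n n"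
    using sep unfolding separated_by_def by (elim exE conjE)
  obtain fs where fs: "set fs = F" "length fs = card F"
    using F(1) by (metis distinct_card finite_distinct_list)
  define T where "T A = vec (card F) (\<lambda>i. (fs ! i) A)" for A
  interpret W: vec_space "TYPE('a)" "card F" .
  have lin: "linear_functional n (fs ! i)" if "i < card F" for i
    using F(3) fs that by (metis nth_mem)
  have add: "(fs ! i) (A + B) = (fs ! i) A + (fs ! i) B" if "i < card F" "A \<in> Z" "B \<in> Z" for i A B
    using lin[OF that(1)] that Zc unfolding linear_functional_def by blast
  have smult: "(fs ! i) (c \<cdot>\<^sub>m A) = c * (fs ! i) A" if "i < card F" "A \<in> Z" for i A c
    using lin[OF that(1)] that Zc unfolding linear_functional_def by blast
  have Tadd: "T (A + B) = T A + T B" if "A \<in> Z" "B \<in> Z" for A B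
    using add that unfolding T_def by (intro eq_vecI) auto
  have Tsmult: "T (c \<cdot>\<^sub>m A) = c \<cdot>\<^sub>v T A" if "A \<in> Z" for A c
    using smult that unfolding T_def by (intro eq_vecI) auto
  have "T \<in> LinearCombinations.module_hom class_ring (?M\<lparr>carrier := Z\<rparr>) W.V"
    using Tadd Tsmult
    by (auto simp: LinearCombinations.module_hom_def module_mat_simps module_vec_simps class_ring_simps T_def)
  then interpret T: linear_map class_ring "?M\<lparr>carrier := Z\<rparr>" W.V T
    by (rule linear_mapI[OF Zvs vec_vs])
  have "inj_on T Z"
  proof (rule inj_onI)
    fix A B assume AB: "A \<in> Z" "B \<in> Z" "T A = T B"
    have mB: "(- 1) \<cdot>\<^sub>m B \<in> Z" using Zclosed(2) AB(2) by blast
    have D: "A + (- 1) \<cdot>\<^sub>m B \<in> Z" using Zclosed(1) AB(1) mB by blast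
    have TD: "T (A + (- 1) \<cdot>\<^sub>m B) = 0\<^sub>v (card F)"
      unfolding Tadd[OF AB(1) mB] Tsmult[OF AB(2)] AB(3) by (auto simp: T_def intro!: eq_vecI)
    have "f (A + (- 1) \<cdot>\<^sub>m B) = 0" if f: "f \<in> F" for f
    proof -
      obtain i where i: "i < card F" "f = fs ! i" using fs f by (metis in_set_conv_nth)
      then show ?thesis using arg_cong[OF TD, of "\<lambda>v. v $ i"] by (simp add: T_def)
    qed
    then have 0: "A + (- 1) \<cdot>\<^sub>m B = 0\<^sub>m n n" using F(4) D by blast
    show "A = B"
    proof (rule eq_matI)
      fix i j assume ij: "i < dim_row B" "j < dim_col B"
      have "A \<in> carrier_mat n n" "B \<in> carrier_mat n n" using AB Zc by auto
      then show "A $$ (i, j) = B $$ (i, j)"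
        using arg_cong[OF 0, of "\<lambda>X. X $$ (i, j)"] ij by simp
    qed (use AB Zc in auto)
  qed
  then have inj: "inj_on T (carrier (?M\<lparr>carrier := Z\<rparr>))" by simp
  show "vectorspace.fin_dim class_ring (?M\<lparr>carrier := Z\<rparr>)"
    using T.inj_dim_le(1)[OF inj W.fin_dim] .
  show "vectorspace.dim class_ring (?M\<lparr>carrier := Z\<rparr>) \<le> d"
    using T.inj_dim_le(2)[OF inj W.fin_dim] F(2) W.dim_is_n by simp
qed

text \<open>The functionals are pulled back along B \<mapsto> Q B P, which is injective because P (Q
  B P) Q = B.\<close>

lemma separated_by_similar:
  fixes Z :: "'a::field mat set"
  assumes P: "P \<in> carrier_mat n n" and Q: "Q \<in> carrier_mat n n"
    and PQ: "P * Q = 1\<^sub>m n" and Z: "Z \<subseteq> carrier_mat n n"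
    and sep: "separated_by n ((\<lambda>B. Q * B * P) ` Z) d"
  shows "separated_by n Z d"
proof -
  obtain F where F: "finite F" "card F \<le> d" "\<forall>f\<in>F. linear_functional n f"
    "\<forall>A\<in>(\<lambda>B. Q * B * P) ` Z. (\<forall>f\<in>F. f A = 0) \<longrightarrow> A = 0\<^sub>m n n"
    using sep unfolding separated_by_def by (elim exE conjE)
  let ?c = "\<lambda>B. Q * B * P"
  show ?thesis
    unfolding separated_by_def
  proof (intro exI[of _ "(\<lambda>f. f \<circ> ?c) ` F"] conjI ballI impI)
    show "card ((\<lambda>f. f \<circ> ?c) ` F) \<le> d" using card_image_le[OF F(1)] F(2) le_trans by blast
    fix f assume "f \<in> (\<lambda>f. f \<circ> ?c) ` F"
    then obtain g where g: "linear_functional n g" "f = g \<circ> ?c" using F(3) by blast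
    have "?c (A + B) = ?c A + ?c B" if "A \<in> carrier_mat n n" "B \<in> carrier_mat n n" for A B
      using that P Q by (simp add: mult_add_distrib_mat[of _ n n] add_mult_distrib_mat[of _ n n])
    moreover have "?c (k \<cdot>\<^sub>m A) = k \<cdot>\<^sub>m ?c A" if "A \<in> carrier_mat n n" for k A
      using that P Q by (simp add: mult_smult_distrib[of _ n n] mult_smult_assoc_mat[of _ n n])
    moreover have "?c A \<in> carrier_mat n n" if "A \<in> carrier_mat n n" for A using that P Q by simp
    ultimately show "linear_functional n f"
      using g by (simp add: linear_functional_def)
  next
    fix B assume B: "B \<in> Z" and z: "\<forall>f\<in>(\<lambda>f. f \<circ> ?c) ` F. f B = 0"
    have Bc: "B \<in> carrier_mat n n" using B Z by blast
    have "\<forall>f\<in>F. f (?c B) = 0" using z by simp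
    then have 0: "?c B = 0\<^sub>m n n" using F(4) B by blast
    have "B = (P * Q) * B * (P * Q)" using Bc PQ by simp
    also have "\<dots> = P * ?c B * Q"
      using P Q Bc by (simp add: assoc_mult_mat[of _ n n _ n _ n])
    also have "\<dots> = 0\<^sub>m n n" using P Q unfolding 0 by simp
    finally show "B = 0\<^sub>m n n" .
  qed (use F(1) in simp)
qed

lemma regular_nilpotent_similar:
  fixes A :: "'a::field mat"
  assumes P: "P \<in> carrier_mat n n" and Q: "Q \<in> carrier_mat n n"
    and PQ: "P * Q = 1\<^sub>m n" and QP: "Q * P = 1\<^sub>m n" and reg: "regular_nilpotent n A"
  shows "regular_nilpotent n (Q * A * P)"
proof -
  have A: "A \<in> carrier_mat n n" using reg by (simp add: regular_nilpotent_def)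
  have C: "Q * A * P \<in> carrier_mat n n" using A P Q by simp
  have mult: "(Q * A * P) *\<^sub>v v = Q *\<^sub>v (A *\<^sub>v (P *\<^sub>v v))" if "v \<in> carrier_vec n" for v
    using that A P Q by (simp add: assoc_mult_mat_vec[of _ n n _ n])
  have PQv: "P *\<^sub>v (Q *\<^sub>v v) = v" if "v \<in> carrier_vec n" for v
    using that P Q PQ by (simp flip: assoc_mult_mat_vec[of _ n n _ n])
  have QPv: "Q *\<^sub>v (P *\<^sub>v v) = v" if "v \<in> carrier_vec n" for v
    using that P Q QP by (simp flip: assoc_mult_mat_vec[of _ n n _ n])
  have it: "iter (Q * A * P) k v = Q *\<^sub>v iter A k (P *\<^sub>v v)" if v: "v \<in> carrier_vec n" for k v
  proof (induction k)
    case (Suc k)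
    have w: "iter A k (P *\<^sub>v v) \<in> carrier_vec n" using A P v by simp
    then show ?case using Suc mult[of "Q *\<^sub>v iter A k (P *\<^sub>v v)"] PQv Q by simp
  qed (use QPv v in simp)
  have Q0: "Q *\<^sub>v 0\<^sub>v n = 0\<^sub>v n" and P0: "P *\<^sub>v 0\<^sub>v n = 0\<^sub>v n" using P Q by auto
  obtain k where k: "\<forall>v\<in>carrier_vec n. iter A k v = 0\<^sub>v n"
    using reg nilpotent_mat_iff_iter[OF A] by (auto simp: regular_nilpotent_def)
  then have "\<forall>v\<in>carrier_vec n. iter (Q * A * P) k v = 0\<^sub>v n"
    using it P Q0 by simp
  then have "nilpotent_mat (Q * A * P)" using nilpotent_mat_iff_iter[OF C] by blast
  moreover obtain u where u: "\<forall>v\<in>carrier_vec n. A *\<^sub>v v = 0\<^sub>v n \<longrightarrow> (\<exists>c. v = c \<cdot>\<^sub>v u)"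
    using reg by (auto simp: regular_nilpotent_def)
  have "\<exists>c. v = c \<cdot>\<^sub>v (Q *\<^sub>v u)" if v: "v \<in> carrier_vec n" "(Q * A * P) *\<^sub>v v = 0\<^sub>v n" for v
  proof (cases "v = 0\<^sub>v n")
    case True
    then have "v = 0 \<cdot>\<^sub>v (Q *\<^sub>v u)" using Q by (auto intro!: eq_vecI)
    then show ?thesis ..
  next
    case False
    have Pv: "P *\<^sub>v v \<in> carrier_vec n" using P v by simp
    have "A *\<^sub>v (P *\<^sub>v v) = P *\<^sub>v (Q *\<^sub>v (A *\<^sub>v (P *\<^sub>v v)))"
      using PQv[of "A *\<^sub>v (P *\<^sub>v v)"] A Pv by simp
    also have "\<dots> = 0\<^sub>v n" using mult[OF v(1)] v(2) P0 by simp
    finally obtain c where c: "P *\<^sub>v v = c \<cdot>\<^sub>v u" using u Pv by blast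
    have "u \<in> carrier_vec n" using c Pv by (metis smult_carrier_vec)
    then have "v = c \<cdot>\<^sub>v (Q *\<^sub>v u)" using QPv[OF v(1)] c Q by (simp add: mult_mat_vec[OF Q])
    then show ?thesis ..
  qed
  ultimately show ?thesis using C unfolding regular_nilpotent_def by blast
qed

section \<open>The theorem\<close>

lemma affine_subspace_along_matD:
  fixes Z S :: "'a::field mat set"
  assumes "affine_subspace_along class_ring (mat_space TYPE('a) n) Z S"
  obtains a where "a \<in> carrier_mat n n" "S = (+) a ` Z" "Z \<subseteq> carrier_mat n n" "0\<^sub>m n n \<in> Z"
    "\<And>A B. A \<in> Z \<Longrightarrow> B \<in> Z \<Longrightarrow> A + B \<in> Z" "\<And>c A. A \<in> Z \<Longrightarrow> c \<cdot>\<^sub>m A \<in> Z"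
proof -
  let ?M = "mat_space TYPE('a) n"
  obtain a where sub: "VectorSpace.subspace class_ring Z ?M"
    and a: "a \<in> carrier ?M" "S = a <+\<^bsub>?M\<^esub> Z"
    using assms unfolding affine_subspace_along_def by blast
  have subm: "submodule class_ring Z ?M"
    using sub by (simp add: VectorSpace.subspace_def)
  have "S = (+) a ` Z"
    unfolding a(2) a_l_coset_def l_coset_def by (auto simp: module_mat_simps)
  moreover have "a \<in> carrier_mat n n" using a(1) by (simp add: module_mat_simps)
  moreover have "Z \<subseteq> carrier_mat n n" "0\<^sub>m n n \<in> Z"
    using submodule.subset[OF subm] submodule.zero_closed[OF subm] by (simp_all add: module_mat_simps)
  moreover have "A + B \<in> Z" if "A \<in> Z" "B \<in> Z" for A B
    using submodule.m_closed[OF subm that] by (simp add: module_mat_simps)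
  moreover have "c \<cdot>\<^sub>m A \<in> Z" if "A \<in> Z" for A c
    using submodule.smult_closed[OF subm _ that, of c]
    by (simp add: module_mat_simps class_ring_simps)
  ultimately show ?thesis using that by blast
qed

text \<open>As \<open>Z\<close> contains 0, the base point \<open>a\<close> is itself regular
  nilpotent. Conjugation with a Jordan basis of \<open>a\<close> turns \<open>S\<close> into J plus
  the conjugate of \<open>Z\<close>, and a bound on the number of separating functionals carries
  back.\<close>

lemma affine_nilpotent_separated:
  fixes Z S :: "'a::field mat set"
  assumes n: "1 \<le> n" and K: "infinite (UNIV :: 'a set) \<or> n + 1 \<le> card (UNIV :: 'a set)"
    and along: "affine_subspace_along class_ring (mat_space TYPE('a) n) Z S"
    and S: "\<And>A. A \<in> S \<Longrightarrow> nilpotent_mat A \<and> vec_space.rank n A = n - 1"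
  shows "separated_by n Z ((n - 1) * (n - 2) div 2)"
proof -
  interpret vec_space "TYPE('a)" n .
  obtain a where a: "a \<in> carrier_mat n n" "S = (+) a ` Z"
    and Z: "Z \<subseteq> carrier_mat n n" "0\<^sub>m n n \<in> Z"
      "\<And>A B. A \<in> Z \<Longrightarrow> B \<in> Z \<Longrightarrow> A + B \<in> Z" "\<And>c A. A \<in> Z \<Longrightarrow> c \<cdot>\<^sub>m A \<in> Z"
    using affine_subspace_along_matD[OF along] by metis
  have reg: "regular_nilpotent n (a + B)" if B: "B \<in> Z" for B
  proof -
    have c: "a + B \<in> carrier_mat n n" using B a(1) Z(1) by auto
    have "a + B \<in> S" using a(2) B by blast
    then show ?thesis
      using S rank_kernel_line[OF c] n c by (simp add: regular_nilpotent_def)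
  qed
  have "a + 0\<^sub>m n n = a" using a(1) by simp
  then have "regular_nilpotent n a" using reg[OF Z(2)] by simp
  then obtain P Q where PQ: "P \<in> carrier_mat n n" "Q \<in> carrier_mat n n"
    "P * Q = 1\<^sub>m n" "Q * P = 1\<^sub>m n" "Q * a * P = jordan_block n 0"
    using jordan_basis_exists[of a] n unfolding regular_nilpotent_def by auto
  let ?c = "\<lambda>B. Q * B * P"
  have add: "?c (A + B) = ?c A + ?c B" if "A \<in> carrier_mat n n" "B \<in> carrier_mat n n" for A B
    using that PQ by (simp add: mult_add_distrib_mat[of _ n n] add_mult_distrib_mat[of _ n n])
  have smult: "?c (k \<cdot>\<^sub>m A) = k \<cdot>\<^sub>m ?c A" if "A \<in> carrier_mat n n" for k A
    using that PQ by (simp add: mult_smult_distrib[of _ n n] mult_smult_assoc_mat[of _ n n])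
  obtain m where m: "n = Suc m" using n by (cases n) auto
  have Zc: "A \<in> carrier_mat n n" if "A \<in> Z" for A using that Z(1) by blast
  have "separated_by n (?c ` Z) (m * (m - 1) div 2)"
    unfolding m
  proof (rule regular_nilpotent_affine_separated, unfold m[symmetric])
    show "infinite (UNIV :: 'a set) \<or> n < card (UNIV :: 'a set)" using K by auto
    show "?c ` Z \<subseteq> carrier_mat n n" using Zc PQ by auto
    have "?c (0\<^sub>m n n) = 0\<^sub>m n n" using PQ by simp
    then show "0\<^sub>m n n \<in> ?c ` Z" using Z(2) by (metis imageI)
    show "A + B \<in> ?c ` Z" if AB: "A \<in> ?c ` Z" "B \<in> ?c ` Z" for A B
    proof -
      obtain A' B' where A'B': "A' \<in> Z" "B' \<in> Z" "A = ?c A'" "B = ?c B'" using AB by blast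
      then have "A + B = ?c (A' + B')" using add Zc by simp
      then show ?thesis using Z(3) A'B' by blast
    qed
    show "k \<cdot>\<^sub>m A \<in> ?c ` Z" if A: "A \<in> ?c ` Z" for k A
    proof -
      obtain A' where A': "A' \<in> Z" "A = ?c A'" using A by blast
      then have "k \<cdot>\<^sub>m A = ?c (k \<cdot>\<^sub>m A')" using smult Zc by simp
      then show ?thesis using Z(4) A' by blast
    qed
    show "regular_nilpotent n (jordan_block n 0 + B)" if B: "B \<in> ?c ` Z" for B
    proof -
      obtain B' where B': "B' \<in> Z" "B = ?c B'" using B by blast
      have "jordan_block n 0 + B = ?c (a + B')" using add[OF a(1) Zc[OF B'(1)]] B' PQ(5) by simp
      then show ?thesis using regular_nilpotent_similar[OF PQ(1-4) reg[OF B'(1)]] by simp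
    qed
  qed
  then show ?thesis
    using separated_by_similar[OF PQ(1-3) Z(1)] by (simp add: m)
qed

text \<open>Finite-dimensionality is recorded as well, since the lower bound for the dimension of
  the extremal example depends on it.\<close>

lemma affine_nilpotent_dim_le:
  fixes S :: "'a::field mat set"
  assumes n: "1 \<le> n" and K: "infinite (UNIV :: 'a set) \<or> n + 1 \<le> card (UNIV :: 'a set)"
    and along: "affine_subspace_along class_ring (mat_space TYPE('a) n) Z S"
    and S: "\<And>A. A \<in> S \<Longrightarrow> nilpotent_mat A \<and> vec_space.rank n A = n - 1"
  shows "vectorspace.fin_dim class_ring ((mat_space TYPE('a) n)\<lparr>carrier := Z\<rparr>)"
    and "affine_subspace_dim class_ring (mat_space TYPE('a) n) S \<le> (n - 1) * (n - 2) div 2"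
proof -
  have sub: "VectorSpace.subspace class_ring Z (mat_space TYPE('a) n)"
    using along by (simp add: affine_subspace_along_def)
  note sep = affine_nilpotent_separated[OF n K along S]
  show "vectorspace.fin_dim class_ring ((mat_space TYPE('a) n)\<lparr>carrier := Z\<rparr>)"
    using separated_by_dim_le(1)[OF sub sep] .
  show "affine_subspace_dim class_ring (mat_space TYPE('a) n) S \<le> (n - 1) * (n - 2) div 2"
    using separated_by_dim_le(2)[OF sub sep]
    by (simp add: affine_subspace_dim_def affine_direction_eq[OF along])
qed

section \<open>The extremal example: matrices supported strictly above the superdiagonal\<close>

lemma card_second_superdiagonal_positions:
  "card {(i, j). i + 2 \<le> j \<and> j < n} = (n - 1) * (n - 2) div (2::nat)"
proof (induction n)
  case (Suc n)
  have fin: "finite {(i, j). i + 2 \<le> j \<and> j < n}"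
    by (rule finite_subset[of _ "{..<n} \<times> {..<n}"]) auto
  \<comment> \<open>Passing from n to n + 1 adds column n, which has n - 1 positions.\<close>
  have "{(i, j). i + 2 \<le> j \<and> j < Suc n} = {(i, j). i + 2 \<le> j \<and> j < n} \<union> (\<lambda>i. (i, n)) ` {..<n - 1}"
    by auto
  also have "card \<dots> = (n - 1) * (n - 2) div 2 + (n - 1)"
    by (subst card_Un_disjoint) (use fin Suc in \<open>auto simp: card_image inj_on_def\<close>)
  also have "\<dots> = ((n - 1) * (n - 2) + (n - 1) * 2) div 2" by simp
  also have "(n - 1) * (n - 2) + (n - 1) * 2 = (Suc n - 1) * (Suc n - 2)"
    by (cases n; cases "n - 1") auto
  finally show ?case .
qed simp

text \<open>The superdiagonal consists of ones, so back substitution determines the kernel.\<close>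

lemma jordan_block_plus_upper_nilpotent:
  fixes B :: "'a::field mat"
  assumes n: "1 \<le> n" and B: "B \<in> carrier_mat n n"
    and B0: "\<And>i j. i < n \<Longrightarrow> j < n \<Longrightarrow> j < i + 2 \<Longrightarrow> B $$ (i, j) = 0"
  shows "nilpotent_mat (jordan_block n 0 + B)"
    and "vec_space.rank n (jordan_block n 0 + B) = n - 1"
proof -
  interpret vec_space "TYPE('a)" n .
  define A where "A = jordan_block n 0 + B"
  have A: "A \<in> carrier_mat n n" using B by (simp add: A_def)
  have A0: "A $$ (i, j) = 0" if "i < n" "j \<le> i" for i j
    using that B B0[of i j] by (simp add: A_def)
  have A1: "A $$ (i, Suc i) = 1" if "Suc i < n" for i
    using that B B0[of i "Suc i"] by (simp add: A_def)
  have mult: "(A *\<^sub>v v) $ i = (\<Sum>j<n. A $$ (i, j) * v $ j)" if "i < n" "v \<in> carrier_vec n" for i v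
    using that A by (simp add: scalar_prod_def atLeast0LessThan)
  \<comment> \<open>\<open>A\<close> is strictly upper triangular, so each application clears one
    more trailing entry.\<close>
  have "iter A k v $ i = 0" if v: "v \<in> carrier_vec n" and i: "i < n" "n \<le> i + k" for k v i
    using i
  proof (induction k arbitrary: i)
    case (Suc k)
    have w: "iter A k v \<in> carrier_vec n" using A v by simp
    have "A $$ (i, j) * iter A k v $ j = 0" if "j < n" for j
      using A0[of i j] Suc that by (cases "j \<le> i") auto
    then have "(\<Sum>j<n. A $$ (i, j) * iter A k v $ j) = 0"
      by (intro sum.neutral) simp
    then show ?case using mult[OF Suc.prems(1) w] by simp
  qed simp
  then have "\<forall>v\<in>carrier_vec n. iter A n v = 0\<^sub>v n"
    using A by (auto intro!: eq_vecI)
  then show "nilpotent_mat (jordan_block n 0 + B)"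
    using nilpotent_mat_iff_iter[OF A] by (auto simp: A_def)
  have "rank A = n - 1"
  proof (rule kernel_line_rank[OF A, where u = "unit_vec n 0"])
    show "A *\<^sub>v unit_vec n 0 = 0\<^sub>v n"
    proof (rule eq_vecI)
      fix i assume "i < dim_vec (0\<^sub>v n)"
      then have i: "i < n" by simp
      have "A $$ (i, j) * unit_vec n 0 $ j = 0" if "j < n" for j
        using A0[of i j] i that by (cases "j = 0") auto
      then have "(\<Sum>j<n. A $$ (i, j) * unit_vec n 0 $ j) = 0"
        by (intro sum.neutral) simp
      then show "(A *\<^sub>v unit_vec n 0) $ i = 0\<^sub>v n $ i" using mult[OF i unit_vec_carrier] i by simp
    qed (use A in simp)
    show "unit_vec n 0 \<noteq> (0\<^sub>v n :: 'a vec)" using n by simp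
    fix v assume v: "v \<in> carrier_vec n" "A *\<^sub>v v = 0\<^sub>v n"
    have tail: "v $ j = 0" if "0 < j" "j < n" for j
      using that
    proof (induction "n - j" arbitrary: j rule: less_induct)
      case less
      \<comment> \<open>Row j - 1 of A v = 0 expresses entry j of v through later entries, which
        vanish by induction.\<close>
      obtain i where i: "j = Suc i" using less.prems by (cases j) auto
      have "A $$ (i, l) * v $ l = (if l = j then v $ j else 0)" if l: "l < n" for l
      proof (cases "l \<le> i")
        case False
        have "v $ l = 0" if "l \<noteq> j"
          by (rule less.hyps) (use that False i l in auto)
        then show ?thesis using A1[of i] i less.prems by auto
      qed (use A0[of i l] i less.prems in auto)
      then have "(A *\<^sub>v v) $ i = (\<Sum>l<n. if l = j then v $ j else 0)"
        using mult[of i v] v i less.prems by simp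
      then show ?case using v i less.prems by simp
    qed
    have "v = v $ 0 \<cdot>\<^sub>v unit_vec n 0"
      by (rule eq_vecI) (use v tail in \<open>auto simp: unit_vec_def\<close>)
    then show "\<exists>c. v = c \<cdot>\<^sub>v unit_vec n 0" ..
  qed (use n in auto)
  then show "vec_space.rank n (jordan_block n 0 + B) = n - 1" by (simp add: A_def)
qed

text \<open>The direction of the extremal affine space. Adding such a matrix to the Jordan block
  keeps the ones on the superdiagonal and the zeros below it.\<close>

definition second_upper_mats :: "nat \<Rightarrow> 'a::field mat set" where
  "second_upper_mats n =
    {B \<in> carrier_mat n n. \<forall>i j. i < n \<longrightarrow> j < n \<longrightarrow> j < i + 2 \<longrightarrow> B $$ (i, j) = 0}"

lemma subspace_second_upper_mats:
  "VectorSpace.subspace class_ring (second_upper_mats n) (mat_space TYPE('a::field) n)"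
proof -
  have "Module.module class_ring (mat_space TYPE('a) n)"
    using vectorspace_mat_space vectorspace_def by blast
  then have "submodule class_ring (second_upper_mats n) (mat_space TYPE('a) n)"
    by (auto simp: submodule_def second_upper_mats_def module_mat_simps class_ring_simps)
  then show ?thesis using vectorspace_mat_space by (simp add: VectorSpace.subspace_def)
qed

text \<open>The free positions are numbered by a bijection \<open>h\<close>; filling them with the
  entries of a vector is an injective linear map.\<close>

lemma dim_second_upper_mats_ge:
  assumes fd: "vectorspace.fin_dim class_ring ((mat_space TYPE('a::field) n)\<lparr>carrier := second_upper_mats n\<rparr>)"
  shows "(n - 1) * (n - 2) div 2 \<le>
    vectorspace.dim class_ring ((mat_space TYPE('a::field) n)\<lparr>carrier := second_upper_mats n\<rparr>)"
proof -
  let ?I = "{(i, j). i + 2 \<le> j \<and> j < n}"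
  let ?M = "(mat_space TYPE('a) n)\<lparr>carrier := second_upper_mats n\<rparr>"
  have "finite ?I" by (rule finite_subset[of _ "{..<n} \<times> {..<n}"]) auto
  then obtain h where h: "bij_betw h ?I {0..<card ?I}"
    using ex_bij_betw_finite_nat by blast
  have h_less: "h (i, j) < card ?I" if "i + 2 \<le> j" "j < n" for i j
    using h that by (auto simp: bij_betw_def)
  interpret V: vec_space "TYPE('a)" "card ?I" .
  define T :: "'a vec \<Rightarrow> 'a mat"
    where "T v = mat n n (\<lambda>(i, j). if i + 2 \<le> j then v $ h (i, j) else 0)" for v
  have Mvs: "vectorspace class_ring ?M"
    by (rule vectorspace.subspace_is_vs[OF vectorspace_mat_space subspace_second_upper_mats])
  have "T \<in> LinearCombinations.module_hom class_ring V.V ?M"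
    using h_less
    by (auto simp: LinearCombinations.module_hom_def module_mat_simps module_vec_simps
        class_ring_simps T_def second_upper_mats_def intro!: eq_matI)
  then interpret T: linear_map class_ring V.V ?M T
    by (rule linear_mapI[OF vec_vs Mvs])
  have "inj_on T (carrier_vec (card ?I))"
  proof (rule inj_onI)
    fix v w assume vw: "v \<in> carrier_vec (card ?I)" "w \<in> carrier_vec (card ?I)" "T v = T w"
    show "v = w"
    proof (rule eq_vecI)
      fix k assume "k < dim_vec w"
      then have "k \<in> h ` ?I" using vw h by (auto simp: bij_betw_def)
      then obtain i j where ij: "i + 2 \<le> j" "j < n" "k = h (i, j)" by blast
      then show "v $ k = w $ k"
        using arg_cong[OF vw(3), of "\<lambda>A. A $$ (i, j)"] by (simp add: T_def)
    qed (use vw in simp)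
  qed
  then have "inj_on T (carrier V.V)" by (simp add: module_vec_simps)
  then show ?thesis
    using T.inj_dim_le(2)[OF _ fd] V.dim_is_n card_second_superdiagonal_positions[of n] by simp
qed

theorem theorem1p4:
  fixes n :: nat
    and M :: "('a::field, 'a mat) module"
    and admissible :: "'a mat set \<Rightarrow> bool"
  defines "M \<equiv> mat_space TYPE('a) n"
    and "admissible \<equiv> \<lambda>S. affine_subspace class_ring M S \<and>
           (\<forall>A \<in> S. nilpotent_mat A \<and> vec_space.rank n A = n - 1)"
  assumes "n \<ge> 1"
    and "infinite (UNIV :: 'a set) \<or> card (UNIV :: 'a set) \<ge> n + 1"
  shows "(\<exists>S. admissible S \<and> affine_subspace_dim class_ring M S = (n - 1) * (n - 2) div 2) \<and>
         (\<forall>S. admissible S \<longrightarrow> affine_subspace_dim class_ring M S \<le> (n - 1) * (n - 2) div 2)"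
proof
  show "\<forall>S. admissible S \<longrightarrow> affine_subspace_dim class_ring M S \<le> (n - 1) * (n - 2) div 2"
    using affine_nilpotent_dim_le(2)[OF assms(3,4)]
    unfolding M_def admissible_def affine_subspace_def by blast
  define S where "S = jordan_block n (0::'a) <+\<^bsub>M\<^esub> second_upper_mats n"
  have along: "affine_subspace_along class_ring M (second_upper_mats n) S"
    using subspace_second_upper_mats
    unfolding affine_subspace_along_def S_def M_def by (auto simp: module_mat_simps)
  have S: "nilpotent_mat A \<and> vec_space.rank n A = n - 1" if A: "A \<in> S" for A
  proof -
    obtain B where "B \<in> second_upper_mats n" "A = jordan_block n 0 + B"
      using A unfolding S_def M_def a_l_coset_def l_coset_def by (auto simp: module_mat_simps)
    then show ?thesis
      using jordan_block_plus_upper_nilpotent[OF assms(3), of B] by (simp add: second_upper_mats_def)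
  qed
  have "admissible S"
    using along S unfolding admissible_def affine_subspace_def by blast
  moreover have "affine_subspace_dim class_ring M S = (n - 1) * (n - 2) div 2"
  proof (rule antisym)
    show "affine_subspace_dim class_ring M S \<le> (n - 1) * (n - 2) div 2"
      using affine_nilpotent_dim_le(2)[OF assms(3,4)] along S unfolding M_def by blast
    \<comment> \<open>The finiteness required by the lower bound comes from the upper bound
      argument, applied to this \<open>S\<close>.\<close>
    have "vectorspace.fin_dim class_ring (M\<lparr>carrier := second_upper_mats n\<rparr>)"
      using affine_nilpotent_dim_le(1)[OF assms(3,4)] along S unfolding M_def by blast
    then show "(n - 1) * (n - 2) div 2 \<le> affine_subspace_dim class_ring M S"
      unfolding affine_subspace_dim_def affine_direction_eq[OF along] unfolding M_def
      by (rule dim_second_upper_mats_ge)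
  qed
  ultimately show "\<exists>S. admissible S \<and> affine_subspace_dim class_ring M S = (n - 1) * (n - 2) div 2"
    by blast
qed

end
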